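(* Let $\xi:\mathbb{R}^2\to\mathbb{R}$ be smooth, $1$-periodic in both variables, with vanishing average over $[0,1)^2$. There exists a unique pair $(\mathbf\Pi,P)$ with values in $\mathbb{R}[[\mathsf z_k,\mathsf z_{\mathbf n}]]$ such that for every multi-index $\beta$, $\mathbf\Pi_\beta(x,y)$ is a polynomial in $y\in\mathbb{R}^2$ whose coefficients are periodic functions of $x\in\mathbb{R}^2$, $P_\beta=P_\beta(y)$ is a polynomial, and $$\left\{\begin{array}{l}(D_2-D_1^2)\mathbf\Pi+P=\mathbf\Pi^-,\\ \mathbf\Pi^-:=\sum_{k\ge0}\mathsf z_k\mathbf\Pi^kD_1^2\mathbf\Pi+\xi\mathsf 1,\\ \int_{[0,1)^2}\mathbf\Pi(x,y)\,dx=\sum_{\mathbf n\ne\mathbf 0}y^{\mathbf n}\mathsf z_{\mathbf n}.\end{array}\right.$$ It satisfies in addition $$\mathbf\Pi_\beta\not\equiv0\implies \beta=e_{\mathbf n}\text{ for some }\mathbf n\ne\mathbf 0,\ \text{ or }\ [\beta]:=\sum_{k\ge0}k\beta(k)-\sum_{\mathbf n\ne\mathbf 0}\beta(\mathbf n)\ge0.$$ Moreover, $$\mathbf\Pi_{e_{\mathbf n}}(\cdot,y)=y^{\mathbf n}\quad\text{for all }\mathbf n\ne\mathbf 0,$$ $$P(y)=-\Big(\frac{\partial}{\partial y_2}-\frac{\partial^2}{\partial y_1^2}\Big)\sum_{\mathbf n\ne\mathbf 0}y^{\mathbf n}\mathsf z_{\mathbf n}+\int_{[0,1)^2}\mathbf\Pi^-(x,y)\,dx,$$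 $$\deg\mathbf\Pi_\beta\le|\beta|_p:=\sum_{\mathbf n\ne\mathbf 0}|\mathbf n|\,\beta(\mathbf n)\quad\text{for all }\beta.$$
   Context: $\mathbb{N}_0=\{0,1,2,\dots\}$. A multi-index $\beta$ assigns to each $k\in\mathbb{N}_0$ a number $\beta(k)\in\mathbb{N}_0$ and to each $\mathbf n\in\mathbb{N}_0^2\setminus\{\mathbf 0\}$ a number $\beta(\mathbf n)\in\mathbb{N}_0$, all but finitely many equal to $0$; $e_k,e_{\mathbf n}$ are the unit multi-indices. "$\mathbf n\neq\mathbf 0$" always means $\mathbf n\in\mathbb{N}_0^2\setminus\{\mathbf 0\}$; $|\mathbf n|:=n_1+2n_2$ and $y^{\mathbf n}:=y_1^{n_1}y_2^{n_2}$. $\mathbb{R}[[\mathsf z_k,\mathsf z_{\mathbf n}]]$ is the algebra of formal power series in the infinitely many variables $\mathsf z_k$ ($k\ge0$), $\mathsf z_{\mathbf n}$ ($\mathbf n\neq\mathbf 0$): its elements are families $\pi=(\pi_\beta)_\beta$ of reals indexed by multi-indices, with product $(\pi\pi')_\beta=\sum_{\gamma+\gamma'=\beta}\pi_\gamma\pi'_{\gamma'}$ and unit $\mathsf 1$, $\mathsf 1_\beta=\delta_\beta^0$. All identities are understood component-wise in $\beta$ (for each $\beta$ the sum over $k$ is finite). Periodic means $1$-periodic in each of the two variables; periodic coefficients are smooth. $D_i:=\frac{\partial}{\partial x_i}+\frac{\partial}{\partial y_i}$ acts on both the periodic variable $x$ and the polynomial variable $y$; $\xi=\xi(x)$. For a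 polynomial in $y$ with periodic coefficients, $U(x,y)=\sum_{\mathbf n}U_{\mathbf n}(x)y^{\mathbf n}$ (finite sum), $\deg U:=\max\{|\mathbf n|:U_{\mathbf n}\not\equiv0\}$ is the parabolic degree, with $\deg 0=-\infty$. *)

theory Defs
  imports "HOL-Analysis.Analysis" "HOL-Library.Poly_Mapping"
begin

section \<open>Multi-indices\<close>

typedef nzpair = "{n :: nat \<times> nat. n \<noteq> (0, 0)}"
  morphisms pair_of nzpair_of
  by (rule exI[of _ "(1, 0)"]) simp

datatype var = Zk nat | Zn nzpair

type_synonym mindex = "var \<Rightarrow>\<^sub>0 nat"

abbreviation unit_mi :: "var \<Rightarrow> mindex" where
  "unit_mi v \<equiv> Poly_Mapping.single v 1"

definition pnorm :: "nat \<times> nat \<Rightarrow> nat" where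
  "pnorm n = fst n + 2 * snd n"

definition ymon :: "real \<times> real \<Rightarrow> nat \<times> nat \<Rightarrow> real" where
  "ymon y n = fst y ^ fst n * snd y ^ snd n"

text \<open>\<open>Sum_any\<close> is the sum over the (here finite) support of the summand.\<close>

definition bracket :: "mindex \<Rightarrow> int" where
  "bracket \<beta> = Sum_any (\<lambda>k. int k * int (Poly_Mapping.lookup \<beta> (Zk k)))
             - Sum_any (\<lambda>n. int (Poly_Mapping.lookup \<beta> (Zn n)))"

definition pweight :: "mindex \<Rightarrow> nat" where
  "pweight \<beta> = Sum_any (\<lambda>n. pnorm (pair_of n) * Poly_Mapping.lookup \<beta> (Zn n))"

lemma finite_decomp: "finite {(\<gamma>, \<gamma>'). \<gamma> + \<gamma>' = (\<beta> :: mindex)}"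
proof -
  define B where "B = {..Max (insert 0 (Poly_Mapping.lookup \<beta> ` Poly_Mapping.keys \<beta>))}"
  let ?F = "{f. \<forall>x. (x \<in> Poly_Mapping.keys \<beta> \<longrightarrow> f x \<in> B) \<and> (x \<notin> Poly_Mapping.keys \<beta> \<longrightarrow> f x = (0::nat))}"
  have F: "finite ?F"
    by (rule finite_set_of_finite_funs) (auto simp: B_def)
  have le: "Poly_Mapping.lookup \<gamma> \<in> ?F" if "\<And>x. Poly_Mapping.lookup \<gamma> x \<le> Poly_Mapping.lookup \<beta> x" for \<gamma> :: mindex
  proof -
    have "Poly_Mapping.lookup \<beta> x \<le> Max (insert 0 (Poly_Mapping.lookup \<beta> ` Poly_Mapping.keys \<beta>))" if "x \<in> Poly_Mapping.keys \<beta>" for x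
      using that by (intro Max_ge) auto
    then have "Poly_Mapping.lookup \<gamma> x \<in> B" if "x \<in> Poly_Mapping.keys \<beta>" for x
      using order_trans[OF \<open>\<And>x. Poly_Mapping.lookup \<gamma> x \<le> Poly_Mapping.lookup \<beta> x\<close>] that
      unfolding B_def atMost_iff by blast
    moreover have "Poly_Mapping.lookup \<gamma> x = 0" if "x \<notin> Poly_Mapping.keys \<beta>" for x
      using that \<open>\<And>x. Poly_Mapping.lookup \<gamma> x \<le> Poly_Mapping.lookup \<beta> x\<close>[of x] by (simp add: in_keys_iff)
    ultimately show ?thesis
      by (simp add: mem_Collect_eq)
  qed
  let ?G = "{\<gamma> :: mindex. Poly_Mapping.lookup \<gamma> \<in> ?F}"
  have "finite ?G"
  proof (rule finite_imageD)
    show "finite (Poly_Mapping.lookup ` ?G)" by (rule finite_subset[OF _ F]) auto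
    show "inj_on Poly_Mapping.lookup ?G" by (auto simp: inj_on_def)
  qed
  moreover have "{(\<gamma>, \<gamma>'). \<gamma> + \<gamma>' = \<beta>} \<subseteq> ?G \<times> ?G"
    proof (intro subsetI)
    fix x assume "x \<in> {(\<gamma>, \<gamma>'). \<gamma> + \<gamma>' = \<beta>}"
    then have eq: "\<beta> = fst x + snd x" by auto
    have "Poly_Mapping.lookup (fst x) \<in> ?F" "Poly_Mapping.lookup (snd x) \<in> ?F"
      by (rule le; simp add: eq lookup_add)+
    then show "x \<in> ?G \<times> ?G" by (cases x) simp
  qed
  ultimately show ?thesis
    by (meson finite_SigmaI finite_subset)
qed


section \<open>Formal power series in the variables \<open>z\<^sub>k\<close>, \<open>z\<^sub>n\<close>\<close>

typedef zseries = "UNIV :: (mindex \<Rightarrow> real) set"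
  morphisms coef zseries_of
  by simp

lemma coef_zseries_of [simp]: "coef (zseries_of f) = f"
  by (simp add: zseries_of_inverse)

lemma zseries_eqI: "(\<And>\<beta>. coef p \<beta> = coef q \<beta>) \<Longrightarrow> p = q"
  using coef_inject by blast

instantiation zseries :: real_vector
begin
definition "0 = zseries_of (\<lambda>_. 0)"
definition "p + q = zseries_of (\<lambda>\<beta>. coef p \<beta> + coef q \<beta>)"
definition "p - q = zseries_of (\<lambda>\<beta>. coef p \<beta> - coef q \<beta>)"
definition "- p = zseries_of (\<lambda>\<beta>. - coef p \<beta>)"
definition "c *\<^sub>R p = zseries_of (\<lambda>\<beta>. c * coef p \<beta>)"
instance
  by standard
    (auto intro!: zseries_eqI simp: zero_zseries_def plus_zseries_def minus_zseries_def
      uminus_zseries_def scaleR_zseries_def algebra_simps)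
end

lemma coef_simps [simp]:
  "coef 0 \<beta> = 0"
  "coef (p + q) \<beta> = coef p \<beta> + coef q \<beta>"
  "coef (p - q) \<beta> = coef p \<beta> - coef q \<beta>"
  "coef (- p) \<beta> = - coef p \<beta>"
  "coef (c *\<^sub>R p) \<beta> = c * coef p \<beta>"
  by (simp_all add: zero_zseries_def plus_zseries_def minus_zseries_def
      uminus_zseries_def scaleR_zseries_def)

instantiation zseries :: "{one, times}"
begin
definition "1 = zseries_of (\<lambda>\<beta>. if \<beta> = 0 then 1 else 0)"
definition "p * q =
  zseries_of (\<lambda>\<beta>. \<Sum>(\<gamma>, \<gamma>') \<in> {(\<gamma>, \<gamma>'). \<gamma> + \<gamma>' = \<beta>}. coef p \<gamma> * coef q \<gamma>')"
instance ..
end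

lemma coef_one: "coef 1 \<beta> = (if \<beta> = 0 then 1 else 0)"
  by (simp add: one_zseries_def)

lemma coef_mult:
  "coef (p * q) \<beta> = (\<Sum>(\<gamma>, \<gamma>') \<in> {(\<gamma>, \<gamma>'). \<gamma> + \<gamma>' = \<beta>}. coef p \<gamma> * coef q \<gamma>')"
  by (simp add: times_zseries_def)

instance zseries :: "{comm_ring_1, real_algebra_1}"
proof
  fix p q r :: zseries and c :: real
  have fin: "finite {(\<gamma>, \<gamma>'). \<gamma> + \<gamma>' = (\<beta> :: mindex)}" for \<beta>
    by (rule finite_decomp)
  show comm: "p * q = q * p" for p q :: zseries
    by (rule zseries_eqI, unfold coef_mult,
        rule sum.reindex_bij_witness[of _ "\<lambda>(a, b). (b, a)" "\<lambda>(a, b). (b, a)"])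
       (auto simp: add.commute mult.commute)
  show "p * q * r = p * (q * r)"
  proof (rule zseries_eqI)
    fix \<beta>
    let ?D = "\<lambda>\<beta> :: mindex. {(\<gamma>, \<gamma>'). \<gamma> + \<gamma>' = \<beta>}"
    have "coef (p * q * r) \<beta>
        = (\<Sum>x\<in>?D \<beta>. \<Sum>y\<in>?D (fst x). coef p (fst y) * coef q (snd y) * coef r (snd x))"
      by (auto simp: coef_mult sum_distrib_right case_prod_unfold)
    also have "\<dots> = (\<Sum>(x, y)\<in>(SIGMA x:?D \<beta>. ?D (fst x)).
        coef p (fst y) * coef q (snd y) * coef r (snd x))"
      by (rule sum.Sigma) (use fin in auto)
    also have "\<dots> = (\<Sum>(x, y)\<in>(SIGMA x:?D \<beta>. ?D (snd x)).
        coef p (fst x) * (coef q (fst y) * coef r (snd y)))"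
      by (rule sum.reindex_bij_witness[of _
            "\<lambda>((a, s), (b, c)). ((a + b, c), (a, b))" "\<lambda>((s, c), (a, b)). ((a, b + c), (b, c))"])
         (auto simp: add.assoc mult.assoc)
    also have "\<dots> = (\<Sum>x\<in>?D \<beta>. \<Sum>y\<in>?D (snd x). coef p (fst x) * (coef q (fst y) * coef r (snd y)))"
      by (rule sum.Sigma[symmetric]) (use fin in auto)
    also have "\<dots> = coef (p * (q * r)) \<beta>"
      by (auto simp: coef_mult sum_distrib_left case_prod_unfold)
    finally show "coef (p * q * r) \<beta> = coef (p * (q * r)) \<beta>" .
  qed
  show one: "1 * p = p" for p :: zseries
  proof (rule zseries_eqI)
    fix \<beta>
    have "coef (1 * p) \<beta> = (\<Sum>(\<gamma>, \<gamma>')\<in>{(0, \<beta>)}. coef 1 \<gamma> * coef p \<gamma>')"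
      unfolding coef_mult
      by (rule sum.mono_neutral_right) (use fin in \<open>auto simp: coef_one split: if_splits\<close>)
    then show "coef (1 * p) \<beta> = coef p \<beta>" by (simp add: coef_one)
  qed
  show "p * 1 = p" by (simp add: comm[of p] one)
  show distr: "(p + q) * r = p * r + q * r" for p q r :: zseries
    by (rule zseries_eqI) (simp add: coef_mult case_prod_unfold distrib_right sum.distrib)
  show "p * (q + r) = p * q + p * r"
    by (simp only: comm[of p] distr)
  show "(0 :: zseries) \<noteq> 1"
  proof
    assume "(0 :: zseries) = 1"
    then have "coef 0 0 = coef 1 0" by simp
    then show False by (simp add: coef_one)
  qed
  show scl: "c *\<^sub>R p * q = c *\<^sub>R (p * q)" for p q :: zseries
    by (rule zseries_eqI) (simp add: coef_mult case_prod_unfold sum_distrib_left mult.assoc)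
  show "p * c *\<^sub>R q = c *\<^sub>R (p * q)"
    by (simp only: comm[of p] scl)
qed

definition zvar :: "var \<Rightarrow> zseries" where
  "zvar v = zseries_of (\<lambda>\<beta>. if \<beta> = unit_mi v then 1 else 0)"

text \<open>Component-wise sum of a family, meaningful if for every \<open>\<beta>\<close> only finitely many members
  have a nonzero \<open>\<beta>\<close>-component.\<close>

definition zsum :: "('i \<Rightarrow> zseries) \<Rightarrow> zseries" where
  "zsum F = zseries_of (\<lambda>\<beta>. Sum_any (\<lambda>i. coef (F i) \<beta>))"

lemma finite_support_zvar_Zn: "finite {n. coef (c n *\<^sub>R zvar (Zn n)) \<beta> \<noteq> 0}"
proof (rule finite_subset)
  show "{n. coef (c n *\<^sub>R zvar (Zn n)) \<beta> \<noteq> 0} \<subseteq> Zn -` Poly_Mapping.keys \<beta>"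
    by (auto simp: zvar_def split: if_splits)
  show "finite (Zn -` Poly_Mapping.keys \<beta>)"
    by (rule finite_vimageI) (auto simp: inj_def)
qed

lemma finite_support_zvar_Zk: "finite {k. coef (zvar (Zk k) * F k) \<beta> \<noteq> 0}"
proof (rule finite_subset)
  show "{k. coef (zvar (Zk k) * F k) \<beta> \<noteq> 0} \<subseteq> Zk -` Poly_Mapping.keys \<beta>"
  proof clarsimp
    fix k assume "coef (zvar (Zk k) * F k) \<beta> \<noteq> 0"
    then obtain x where x: "x \<in> {(\<gamma>, \<gamma>'). \<gamma> + \<gamma>' = \<beta>}"
        "(case x of (\<gamma>, \<gamma>') \<Rightarrow> coef (zvar (Zk k)) \<gamma> * coef (F k) \<gamma>') \<noteq> 0"
      unfolding coef_mult by (meson sum.neutral)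
    obtain \<gamma> \<gamma>' where [simp]: "x = (\<gamma>, \<gamma>')" by fastforce
    from x have "\<gamma> + \<gamma>' = \<beta>" "\<gamma> = unit_mi (Zk k)"
      by (auto simp: zvar_def split: if_splits)
    then show "Zk k \<in> Poly_Mapping.keys \<beta>" by (auto simp: in_keys_iff lookup_add)
  qed
  show "finite (Zk -` Poly_Mapping.keys \<beta>)"
    by (rule finite_vimageI) (auto simp: inj_def)
qed


section \<open>Smooth and periodic functions, polynomials with periodic coefficients\<close>

primrec times_differentiable ::
    "nat \<Rightarrow> ('a::real_normed_vector \<Rightarrow> 'b::real_normed_vector) \<Rightarrow> bool" where
  "times_differentiable 0 f \<longleftrightarrow> continuous_on UNIV f"
| "times_differentiable (Suc m) f \<longleftrightarrow>
     (\<forall>x. f differentiable (at x)) \<and>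
     (\<forall>v. times_differentiable m (\<lambda>x. frechet_derivative f (at x) v))"

definition smooth :: "('a::real_normed_vector \<Rightarrow> 'b::real_normed_vector) \<Rightarrow> bool" where
  "smooth f \<longleftrightarrow> (\<forall>m. times_differentiable m f)"

definition periodic :: "(real \<times> real \<Rightarrow> real) \<Rightarrow> bool" where
  "periodic f \<longleftrightarrow> (\<forall>x. f (x + (1, 0)) = f x \<and> f (x + (0, 1)) = f x)"

definition unit_cell :: "(real \<times> real) set" where
  "unit_cell = {0..<1} \<times> {0..<1}"

text \<open>\<open>is_ycoeffs U c\<close>: \<open>U(x,y)\<close> is the finite sum of the \<open>c n x * y^n\<close>. The family \<open>c\<close> is
  determined by \<open>U\<close>, see \<open>is_ycoeffs_unique\<close>.\<close>

definition is_ycoeffs ::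
    "(real \<times> real \<Rightarrow> real \<times> real \<Rightarrow> real) \<Rightarrow> (nat \<times> nat \<Rightarrow> real \<times> real \<Rightarrow> real) \<Rightarrow> bool" where
  "is_ycoeffs U c \<longleftrightarrow>
     finite {n. c n \<noteq> (\<lambda>_. 0)} \<and>
     (\<forall>x y. U x y = (\<Sum>n | c n \<noteq> (\<lambda>_. 0). c n x * ymon y n))"

definition periodic_polynomial :: "(real \<times> real \<Rightarrow> real \<times> real \<Rightarrow> real) \<Rightarrow> bool" where
  "periodic_polynomial U \<longleftrightarrow> (\<exists>c. is_ycoeffs U c \<and> (\<forall>n. smooth (c n) \<and> periodic (c n)))"

definition ycoeffs ::
    "(real \<times> real \<Rightarrow> real \<times> real \<Rightarrow> real) \<Rightarrow> nat \<times> nat \<Rightarrow> real \<times> real \<Rightarrow> real" where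
  "ycoeffs U = (THE c. is_ycoeffs U c)"

definition pdeg :: "(real \<times> real \<Rightarrow> real \<times> real \<Rightarrow> real) \<Rightarrow> ereal" where
  "pdeg U = (if U = (\<lambda>_ _. 0) then - \<infinity>
             else ereal (real (Max {pnorm n | n. ycoeffs U n \<noteq> (\<lambda>_. 0)})))"

lemma is_ycoeffs_unique:
  assumes "is_ycoeffs U c" "is_ycoeffs U d"
  shows "c = d"
proof -
  let ?S = "{n. c n \<noteq> (\<lambda>_. 0)} \<union> {n. d n \<noteq> (\<lambda>_. 0)}"
  have fin: "finite ?S"
    using assms by (auto simp: is_ycoeffs_def)
  obtain N where N: "?S \<subseteq> {..N} \<times> {..N}"
  proof
    show "?S \<subseteq> {..Max (insert 0 (fst ` ?S \<union> snd ` ?S))} \<times> {..Max (insert 0 (fst ` ?S \<union> snd ` ?S))}"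
    proof
      fix n assume n: "n \<in> ?S"
      have "fst n \<le> Max (insert 0 (fst ` ?S \<union> snd ` ?S))" "snd n \<le> Max (insert 0 (fst ` ?S \<union> snd ` ?S))"
        by (rule Max_ge; use fin n in blast)+
      then show "n \<in> {..Max (insert 0 (fst ` ?S \<union> snd ` ?S))} \<times> {..Max (insert 0 (fst ` ?S \<union> snd ` ?S))}"
        by (cases n) auto
    qed
  qed
  have expand: "U x y = (\<Sum>i\<le>N. (\<Sum>j\<le>N. e (i, j) x * snd y ^ j) * fst y ^ i)"
    if "is_ycoeffs U e" "{n. e n \<noteq> (\<lambda>_. 0)} \<subseteq> {..N} \<times> {..N}" for e x y
  proof -
    have "U x y = (\<Sum>n | e n \<noteq> (\<lambda>_. 0). e n x * ymon y n)"
      using that(1) unfolding is_ycoeffs_def by blast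
    also have "\<dots> = (\<Sum>n\<in>{..N} \<times> {..N}. e n x * ymon y n)"
      by (rule sum.mono_neutral_left) (use that(2) in auto)
    also have "\<dots> = (\<Sum>i\<le>N. \<Sum>j\<le>N. e (i, j) x * ymon y (i, j))"
      by (simp add: sum.cartesian_product case_prod_unfold)
    finally show ?thesis
      by (simp add: ymon_def sum_distrib_left mult_ac)
  qed
  have zero: "c (i, j) x - d (i, j) x = 0" if "i \<le> N" "j \<le> N" for i j x
  proof -
    have "(\<Sum>i\<le>N. (\<Sum>j\<le>N. (c (i, j) x - d (i, j) x) * b ^ j) * a ^ i) = 0" for a b :: real
      using expand[OF assms(1), of x "(a, b)"] expand[OF assms(2), of x "(a, b)"] N
      by (simp add: left_diff_distrib sum_subtractf)
    then have "(\<Sum>j\<le>N. (c (i, j) x - d (i, j) x) * b ^ j) = 0" for b :: real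
      using polyfun_eq_0[of "\<lambda>i. \<Sum>j\<le>N. (c (i, j) x - d (i, j) x) * b ^ j" N] \<open>i \<le> N\<close> by blast
    then show ?thesis
      using polyfun_eq_0[of "\<lambda>j. c (i, j) x - d (i, j) x" N] \<open>j \<le> N\<close> by blast
  qed
  show "c = d"
  proof (rule ext, rule ext)
    fix n x
    show "c n x = d n x"
    proof (cases "n \<in> {..N} \<times> {..N}")
      case True
      then show ?thesis using zero[of "fst n" "snd n" x] by auto
    next
      case False
      then have "c n = (\<lambda>_. 0)" "d n = (\<lambda>_. 0)" using N by blast+
      then show ?thesis by simp
    qed
  qed
qed

lemma ycoeffs_eqI: "is_ycoeffs U c \<Longrightarrow> ycoeffs U = c"
  unfolding ycoeffs_def by (blast intro: is_ycoeffs_unique)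


section \<open>The system of equations\<close>

text \<open>The unknown, a bold capital Pi in the mathematical notation, is written \<open>\<Phi>\<close>, because
  \<open>\<Pi>\<close> is binder syntax here.\<close>

definition pd :: "real \<times> real \<Rightarrow> (real \<times> real \<Rightarrow> zseries) \<Rightarrow> real \<times> real \<Rightarrow> zseries" where
  "pd v F p = zseries_of (\<lambda>\<beta>. deriv (\<lambda>t. coef (F (p + t *\<^sub>R v)) \<beta>) 0)"

abbreviation pd1 where "pd1 \<equiv> pd (1, 0)"
abbreviation pd2 where "pd2 \<equiv> pd (0, 1)"

definition DD :: "real \<times> real \<Rightarrow> (real \<times> real \<Rightarrow> real \<times> real \<Rightarrow> zseries)
    \<Rightarrow> real \<times> real \<Rightarrow> real \<times> real \<Rightarrow> zseries" where
  "DD v U x y = pd v (\<lambda>x'. U x' y) x + pd v (\<lambda>y'. U x y') y"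

abbreviation D1 where "D1 \<equiv> DD (1, 0)"
abbreviation D2 where "D2 \<equiv> DD (0, 1)"

definition cell_mean :: "(real \<times> real \<Rightarrow> zseries) \<Rightarrow> zseries" where
  "cell_mean F = zseries_of (\<lambda>\<beta>. LINT x:unit_cell|lborel. coef (F x) \<beta>)"

definition component ::
    "(real \<times> real \<Rightarrow> real \<times> real \<Rightarrow> zseries) \<Rightarrow> mindex \<Rightarrow> real \<times> real \<Rightarrow> real \<times> real \<Rightarrow> real" where
  "component U \<beta> = (\<lambda>x y. coef (U x y) \<beta>)"

definition ypoly :: "real \<times> real \<Rightarrow> zseries" where
  "ypoly y = zsum (\<lambda>n. ymon y (pair_of n) *\<^sub>R zvar (Zn n))"

definition Pi_minus :: "(real \<times> real \<Rightarrow> real) \<Rightarrow> (real \<times> real \<Rightarrow> real \<times> real \<Rightarrow> zseries)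
    \<Rightarrow> real \<times> real \<Rightarrow> real \<times> real \<Rightarrow> zseries" where
  "Pi_minus \<xi> \<Phi> x y = zsum (\<lambda>k. zvar (Zk k) * \<Phi> x y ^ k * D1 (D1 \<Phi>) x y) + \<xi> x *\<^sub>R 1"

definition solves :: "(real \<times> real \<Rightarrow> real) \<Rightarrow> (real \<times> real \<Rightarrow> real \<times> real \<Rightarrow> zseries)
    \<Rightarrow> (real \<times> real \<Rightarrow> zseries) \<Rightarrow> bool" where
  "solves \<xi> \<Phi> P \<longleftrightarrow>
     (\<forall>\<beta>. periodic_polynomial (component \<Phi> \<beta>)) \<and>
     (\<forall>\<beta>. real_polynomial_function (\<lambda>y. coef (P y) \<beta>)) \<and>
     (\<forall>x y. D2 \<Phi> x y - D1 (D1 \<Phi>) x y + P y = Pi_minus \<xi> \<Phi> x y) \<and>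
     (\<forall>y. cell_mean (\<lambda>x. \<Phi> x y) = ypoly y)"

end

theory Submission
  imports Defs "HOL-Library.Nat_Bijection"
begin

text \<open>Since \<open>e\<^sub>k + \<gamma> = \<beta>\<close> forces \<open>\<gamma>\<close> to be smaller than \<open>\<beta>\<close> in total degree, the
  \<open>\<beta>\<close>-component of the right-hand side only involves components of the unknown at smaller
  multi-indices, so the system is solved by recursion on the total degree. Each step is a linear
  problem: given a polynomial \<open>F\<close> in \<open>y\<close> with periodic coefficients, find \<open>U\<close> with prescribed
  average and a polynomial \<open>p(y)\<close> such that \<open>(D\<^sub>2 - D\<^sub>1\<^sup>2) U + p = F\<close>. On a monomial \<open>c(x) y\<^sup>n\<close> the
  operator acts as the periodic heat operator on \<open>c\<close>, up to terms of lower parabolic degree, so a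
  descending induction on the degree reduces the problem to the invertibility of the heat operator
  on smooth mean-free periodic functions. There Fourier series apply: the symbol
  \<open>2 \<pi> i k\<^sub>2 + 4 \<pi>\<^sup>2 k\<^sub>1\<^sup>2\<close> has modulus at least one for \<open>k \<noteq> 0\<close>.

  If \<open>[\<beta>] < 0\<close> and \<open>\<beta>\<close> is not a unit multi-index, the right-hand side consists only of products of
  monomials in \<open>y\<close>; it is constant in \<open>x\<close>, hence entirely absorbed by \<open>p\<close>.\<close>


section \<open>Smooth functions and integrals over the unit cell\<close>

text \<open>Two things shape the linear step. The average over x annihilates x-derivatives, so the
  periodic heat operator only reaches mean-free functions; the unknown \<open>P\<close> takes up
  exactly the missing averages, while prescribing the average of the solution removes the constants
  that the operator annihilates. Averaging the equation therefore decides \<open>P\<close>, both for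
  uniqueness and for its explicit formula. Dividing Fourier coefficients by the symbol yields a
  smooth function with the right coefficients; to conclude that it solves the equation pointwise, a
  continuous periodic function must be determined by its coefficients. This is shown by testing
  against powers of a nonnegative trigonometric polynomial with a single peak, so convergence of the
  Fourier series to a given function never has to be proved. The total degree is the order of
  recursion because every factor z_k, including z_0, uses up one unit of it, whereas e_0 has bracket
  0. The degree bound is carried along in the recursion; it belongs to the constructed solution and
  passes to an arbitrary one by uniqueness.\<close>

definition dderiv ::
    "'a::real_normed_vector \<Rightarrow> ('a \<Rightarrow> 'b::real_normed_vector) \<Rightarrow> 'a \<Rightarrow> 'b" where
  "dderiv v f = (\<lambda>x. frechet_derivative f (at x) v)"

lemma times_differentiable_Suc_dderiv:
  "times_differentiable (Suc m) f \<longleftrightarrow>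
     (\<forall>x. f differentiable (at x)) \<and> (\<forall>v. times_differentiable m (dderiv v f))"
  by (simp add: dderiv_def)

lemma dderiv_eqI:
  assumes "\<And>x. (f has_derivative f' x) (at x)"
  shows "dderiv v f = (\<lambda>x. f' x v)"
  using frechet_derivative_at[OF assms] by (auto simp: dderiv_def)

lemma times_differentiable_SucI:
  assumes "\<And>x. (f has_derivative f' x) (at x)"
    and "\<And>v. times_differentiable m (\<lambda>x. f' x v)"
  shows "times_differentiable (Suc m) f"
  unfolding times_differentiable_Suc_dderiv dderiv_eqI[OF assms(1)]
  using assms by (auto simp: differentiable_def)

lemma times_differentiable_SucD:
  "times_differentiable (Suc m) f \<Longrightarrow> times_differentiable m f"
proof (induction m arbitrary: f)
  case 0
  then show ?case
    by (auto simp: continuous_on_eq_continuous_within differentiable_imp_continuous_within)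
next
  case (Suc m)
  then show ?case
    using Suc.IH unfolding times_differentiable_Suc_dderiv by blast
qed

lemma times_differentiable_const: "times_differentiable m (\<lambda>_. c)"
proof (induction m arbitrary: c)
  case (Suc m)
  then show ?case
    by (intro times_differentiable_SucI[OF has_derivative_const]) auto
qed simp

lemma has_derivative_frechet:
  assumes "times_differentiable (Suc m) f"
  shows "(f has_derivative (\<lambda>v. dderiv v f x)) (at x)"
  using assms frechet_derivative_works[of f "at x"] by (auto simp: dderiv_def)

lemma times_differentiable_add:
  assumes "times_differentiable m f" "times_differentiable m g"
  shows "times_differentiable m (\<lambda>x. f x + g x)"
  using assms
proof (induction m arbitrary: f g)
  case (Suc m)
  show ?case
    by (rule times_differentiable_SucI[OF has_derivative_add])
      (use Suc in \<open>auto intro: has_derivative_frechet simp del: times_differentiable.simps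
        simp: times_differentiable_Suc_dderiv\<close>)
qed (auto intro: continuous_intros)

lemma (in bounded_bilinear) times_differentiable_prod:
  assumes "times_differentiable m f" "times_differentiable m g"
  shows "times_differentiable m (\<lambda>x. prod (f x) (g x))"
  using assms
proof (induction m arbitrary: f g)
  case 0
  then show ?case
    by (auto intro: continuous_on)
next
  case (Suc m)
  \<comment> \<open>The Leibniz rule leaves one factor undifferentiated, so the induction hypothesis
    is applied to the factors themselves as well as to their derivatives.\<close>
  have "times_differentiable m f" "times_differentiable m g"
    by (rule times_differentiable_SucD[OF Suc.prems(1)], rule times_differentiable_SucD[OF Suc.prems(2)])
  then show ?case
    using Suc
    by (intro times_differentiable_SucI[OF FDERIV[OF has_derivative_frechet has_derivative_frechet]]
      times_differentiable_add) (auto simp del: times_differentiable.simps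
        simp: times_differentiable_Suc_dderiv)
qed

lemma (in bounded_linear) times_differentiable_compose:
  assumes "times_differentiable m g"
  shows "times_differentiable m (\<lambda>x. f (g x))"
  using assms
proof (induction m arbitrary: g)
  case 0
  then show ?case
    by (auto intro: continuous_on)
next
  case (Suc m)
  then show ?case
    by (intro times_differentiable_SucI[OF has_derivative[OF has_derivative_frechet]])
      (auto simp del: times_differentiable.simps simp: times_differentiable_Suc_dderiv)
qed

lemma smooth_const: "smooth (\<lambda>_. c)"
  by (simp add: smooth_def times_differentiable_const)

lemma smooth_add: "smooth f \<Longrightarrow> smooth g \<Longrightarrow> smooth (\<lambda>x. f x + g x)"
  by (simp add: smooth_def times_differentiable_add)

lemma (in bounded_bilinear) smooth_prod: "smooth f \<Longrightarrow> smooth g \<Longrightarrow> smooth (\<lambda>x. prod (f x) (g x))"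
  by (simp add: smooth_def times_differentiable_prod)

lemma (in bounded_linear) smooth_compose: "smooth g \<Longrightarrow> smooth (\<lambda>x. f (g x))"
  by (simp add: smooth_def times_differentiable_compose)

lemmas smooth_mult = bounded_bilinear.smooth_prod[OF bounded_bilinear_mult]
lemmas smooth_of_real = bounded_linear.smooth_compose[OF bounded_linear_of_real]
lemmas smooth_Re = bounded_linear.smooth_compose[OF bounded_linear_Re]

lemma smooth_cmult:
  fixes c :: "'b::real_normed_algebra"
  shows "smooth f \<Longrightarrow> smooth (\<lambda>x. c * f x)"
  by (intro smooth_mult smooth_const)

lemma smooth_minus: "smooth f \<Longrightarrow> smooth (\<lambda>x. - f x)"
  by (rule bounded_linear.smooth_compose[OF bounded_linear_minus[OF bounded_linear_ident]])

lemma smooth_diff: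
  assumes "smooth f" "smooth g"
  shows "smooth (\<lambda>x. f x - g x)"
  using smooth_add[OF assms(1) smooth_minus[OF assms(2)]] by simp

lemma smooth_dderiv: "smooth f \<Longrightarrow> smooth (dderiv v f)"
  unfolding smooth_def using times_differentiable_Suc_dderiv by blast

lemma smooth_continuous_on: "smooth f \<Longrightarrow> continuous_on S f"
  unfolding smooth_def using continuous_on_subset times_differentiable.simps(1) by blast

lemma smooth_has_derivative: "smooth f \<Longrightarrow> (f has_derivative (\<lambda>v. dderiv v f x)) (at x)"
  unfolding smooth_def using has_derivative_frechet by blast

text \<open>Restricting to a line serves two purposes: the fundamental theorem of calculus along a
  period, and the one-variable \<open>deriv\<close> through which \<open>pd\<close> defines partial
  derivatives.\<close>

lemma smooth_has_vector_derivative_line: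
  assumes "smooth f"
  shows "((\<lambda>t. f (x + t *\<^sub>R v)) has_vector_derivative dderiv v f (x + s *\<^sub>R v)) (at s within S)"
proof -
  have "((\<lambda>t. x + t *\<^sub>R v) has_derivative (\<lambda>t. t *\<^sub>R v)) (at s within S)"
    by (auto intro!: derivative_eq_intros)
  from has_derivative_compose[OF this smooth_has_derivative[OF assms]]
  have "((\<lambda>t. f (x + t *\<^sub>R v)) has_derivative (\<lambda>t. dderiv (t *\<^sub>R v) f (x + s *\<^sub>R v))) (at s within S)" .
  moreover have "dderiv (t *\<^sub>R v) f y = t *\<^sub>R dderiv v f y" for t y
    using linear_scale[OF has_derivative_linear[OF smooth_has_derivative[OF assms]]] by blast
  ultimately show ?thesis
    by (simp add: has_vector_derivative_def)
qed

lemma smooth_has_real_derivative_line: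
  fixes f :: "_ \<Rightarrow> real"
  assumes "smooth f"
  shows "((\<lambda>t. f (x + t *\<^sub>R v)) has_real_derivative dderiv v f x) (at 0)"
  using smooth_has_vector_derivative_line[OF assms, of x v 0 UNIV]
  by (simp add: has_real_derivative_iff_has_vector_derivative)

lemma (in bounded_bilinear) dderiv_prod:
  assumes "smooth f" "smooth g"
  shows "dderiv v (\<lambda>x. prod (f x) (g x)) = (\<lambda>x. prod (f x) (dderiv v g x) + prod (dderiv v f x) (g x))"
  by (rule dderiv_eqI FDERIV smooth_has_derivative assms)+

lemma (in bounded_linear) dderiv_compose:
  assumes "smooth g"
  shows "dderiv v (\<lambda>x. f (g x)) = (\<lambda>x. f (dderiv v g x))"
  by (rule dderiv_eqI has_derivative smooth_has_derivative assms)+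

lemmas dderiv_mult = bounded_bilinear.dderiv_prod[OF bounded_bilinear_mult]
lemmas dderiv_of_real = bounded_linear.dderiv_compose[OF bounded_linear_of_real]
lemmas dderiv_Re = bounded_linear.dderiv_compose[OF bounded_linear_Re]

lemma dderiv_const: "dderiv v (\<lambda>_. c) = (\<lambda>_. 0)"
  by (simp add: dderiv_def)

text \<open>A polymorphic copy of \<open>periodic\<close>, because the Fourier analysis takes place
  among complex-valued functions.\<close>

definition cell_periodic :: "(real \<times> real \<Rightarrow> 'b) \<Rightarrow> bool" where
  "cell_periodic f \<longleftrightarrow> (\<forall>x. f (x + (1, 0)) = f x \<and> f (x + (0, 1)) = f x)"

lemma periodic_iff_cell_periodic: "periodic f \<longleftrightarrow> cell_periodic f"
  by (simp add: periodic_def cell_periodic_def)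

text \<open>Translation by a period does not change \<open>f\<close>, so the derivatives at
  \<open>x\<close> and at \<open>x + w\<close> are both derivatives of \<open>f\<close> at
  \<open>x\<close>, and derivatives are unique.\<close>

lemma cell_periodic_dderiv:
  fixes f :: "real \<times> real \<Rightarrow> 'b::real_normed_vector"
  assumes "smooth f" "cell_periodic f"
  shows "cell_periodic (dderiv v f)"
proof -
  have "dderiv v f (x + w) = dderiv v f x" if "\<And>x. f (x + w) = f x" for x w
  proof -
    have "((\<lambda>x. f (x + w)) has_derivative (\<lambda>v. dderiv v f (x + w))) (at x)"
      by (rule has_derivative_compose[OF _ smooth_has_derivative[OF assms(1)]])
        (auto intro!: derivative_eq_intros)
    then have "(f has_derivative (\<lambda>v. dderiv v f (x + w))) (at x)"
      by (simp only: that)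
    from has_derivative_unique[OF this smooth_has_derivative[OF assms(1)]] show ?thesis
      by (rule fun_cong)
  qed
  moreover have "f (x + (1, 0)) = f x" "f (x + (0, 1)) = f x" for x
    using assms(2) unfolding cell_periodic_def by blast+
  ultimately show ?thesis
    unfolding cell_periodic_def by blast
qed

section \<open>Integrals over the unit cell\<close>

definition cell_integral :: "(real \<times> real \<Rightarrow> 'b) \<Rightarrow> 'b::banach" where
  "cell_integral f = integral (cbox (0, 0) (1, 1)) f"

lemma cell_integrable:
  fixes f :: "real \<times> real \<Rightarrow> 'b::banach"
  shows "continuous_on UNIV f \<Longrightarrow> f integrable_on cbox (0, 0) (1, 1)"
  by (rule integrable_continuous, rule continuous_on_subset[of UNIV]) auto

lemma cell_integral_const [simp]: "cell_integral (\<lambda>_. c) = c"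
  unfolding cell_integral_def by (simp add: content_Pair)

lemma cell_integral_add:
  "continuous_on UNIV f \<Longrightarrow> continuous_on UNIV g \<Longrightarrow>
    cell_integral (\<lambda>x. f x + g x) = cell_integral f + cell_integral g"
  unfolding cell_integral_def by (intro integral_add cell_integrable)

lemma cell_integral_diff:
  "continuous_on UNIV f \<Longrightarrow> continuous_on UNIV g \<Longrightarrow>
    cell_integral (\<lambda>x. f x - g x) = cell_integral f - cell_integral g"
  unfolding cell_integral_def by (intro integral_diff cell_integrable)

lemma cell_integral_cmult:
  fixes c :: "'b::{banach,real_normed_field}"
  shows "cell_integral (\<lambda>x. c * f x) = c * cell_integral f"
  unfolding cell_integral_def by (rule integral_mult_right)

lemma cell_integral_mult_const:
  fixes c :: "'b::{banach,real_normed_field}"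
  shows "cell_integral (\<lambda>x. f x * c) = cell_integral f * c"
  unfolding cell_integral_def by (rule integral_mult_left)

lemma cell_integral_sum:
  "(\<And>i. i \<in> I \<Longrightarrow> continuous_on UNIV (f i)) \<Longrightarrow>
    cell_integral (\<lambda>x. \<Sum>i\<in>I. f i x) = (\<Sum>i\<in>I. cell_integral (f i))"
  by (induction I rule: infinite_finite_induct)
    (auto simp: cell_integral_add continuous_on_sum)

lemma cell_integral_bounded_linear:
  fixes f :: "'a::banach \<Rightarrow> 'b::banach"
  assumes "bounded_linear f" "continuous_on UNIV g"
  shows "cell_integral (\<lambda>x. f (g x)) = f (cell_integral g)"
  unfolding cell_integral_def
  using integral_linear[OF cell_integrable[OF assms(2)] assms(1)] by (simp add: o_def)

text \<open>The half-open cell lies between the open and the closed square, which differ by a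
  negligible set. This links the Lebesgue integral of the problem to the gauge integral used for
  Banach-valued functions.\<close>

lemma set_lebesgue_unit_cell:
  fixes f :: "real \<times> real \<Rightarrow> real"
  assumes "continuous_on UNIV f"
  shows "(LINT x:unit_cell|lborel. f x) = cell_integral f"
proof -
  have cell: "box (0, 0) (1, 1) \<subseteq> unit_cell" "unit_cell \<subseteq> cbox (0, 0) (1::real, 1::real)"
    by (auto simp: unit_cell_def box_def cbox_Pair_eq Basis_prod_def)
  have null: "negligible (cbox (0, 0) (1, 1) - box (0::real, 0::real) (1, 1))"
    by (rule negligible_frontier_interval)
  have "set_integrable lborel (cbox (0, 0) (1, 1)) f"
    unfolding set_integrable_def
    by (intro borel_integrable_compact continuous_on_subset[OF assms]) auto
  moreover have "unit_cell \<in> sets borel"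
    unfolding unit_cell_def by (intro borel_Times) auto
  ultimately have "set_integrable lborel unit_cell f"
    by (metis cell(2) set_integrable_subset sets_lborel)
  from set_borel_integral_eq_integral(2)[OF this]
  have "(LINT x:unit_cell|lborel. f x) = integral unit_cell f" .
  also have "\<dots> = cell_integral f"
    unfolding cell_integral_def
    by (rule integral_spike_set; rule negligible_subset[OF null]) (use cell in auto)
  finally show ?thesis .
qed

text \<open>Fubini reduces to an integral along one period in direction \<open>v\<close>, where the
  fundamental theorem gives a difference of two equal values. For \<open>v = (1, 0)\<close> the
  order of integration has to be swapped, since the iterated integral has the second variable
  inside.\<close>

lemma cell_integral_dderiv:
  fixes f :: "real \<times> real \<Rightarrow> 'b::banach"
  assumes f: "smooth f" "cell_periodic f" and v: "v = (1, 0) \<or> v = (0, 1)"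
  shows "cell_integral (dderiv v f) = 0"
proof -
  have cont: "continuous_on S (dderiv v f)" for S
    by (intro smooth_continuous_on smooth_dderiv f)
  have line: "integral (cbox 0 1) (\<lambda>t. dderiv v f (x + t *\<^sub>R v)) = 0" for x
  proof (rule integral_unique)
    have "((\<lambda>t. dderiv v f (x + t *\<^sub>R v)) has_integral f (x + 1 *\<^sub>R v) - f (x + 0 *\<^sub>R v)) {0..1}"
      by (intro fundamental_theorem_of_calculus smooth_has_vector_derivative_line f) auto
    moreover have "f (x + v) = f x"
      using v f(2) unfolding cell_periodic_def by blast
    ultimately show "((\<lambda>t. dderiv v f (x + t *\<^sub>R v)) has_integral 0) (cbox 0 1)"
      by simp
  qed
  show ?thesis
    using v
  proof
    assume v: "v = (0, 1)"
    have "integral (cbox 0 1) (\<lambda>t. dderiv v f (s, t)) = 0" for s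
      using line[of "(s, 0)"] v by simp
    then show ?thesis
      unfolding cell_integral_def by (subst integral_prod_continuous[OF cont]) simp
  next
    assume v: "v = (1, 0)"
    have "integral (cbox 0 1) (\<lambda>s. dderiv v f (s, t)) = 0" for t
      using line[of "(0, t)"] v by simp
    then show ?thesis
      unfolding cell_integral_def
      by (subst integral_prod_continuous[OF cont], subst integral_swap_continuous)
        (auto intro: cont)
  qed
qed


section \<open>Fourier coefficients and Fourier series\<close>

lemma norm_cell_integral_le:
  assumes "continuous_on UNIV f" "\<And>x. x \<in> cbox (0, 0) (1, 1) \<Longrightarrow> norm (f x) \<le> B"
  shows "norm (cell_integral f) \<le> B"
proof -
  have "norm (f (0, 0)) \<le> B"
    by (rule assms(2)) (auto simp: cbox_Pair_eq)
  then have "0 \<le> B"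
    by (rule order_trans[OF norm_ge_zero])
  from has_integral_bound[OF this integrable_integral[OF cell_integrable[OF assms(1)]] assms(2)]
  show ?thesis
    by (simp add: cell_integral_def content_Pair)
qed

text \<open>One linear form in two roles: at a point it is the exponent of the character
  \<open>wave k\<close>, at a direction it is the Fourier multiplier of the derivative in that
  direction.\<close>

definition freq :: "int \<times> int \<Rightarrow> real \<times> real \<Rightarrow> complex" where
  "freq k v = \<i> * complex_of_real (2 * pi * (of_int (fst k) * fst v + of_int (snd k) * snd v))"

definition wave :: "int \<times> int \<Rightarrow> real \<times> real \<Rightarrow> complex" where
  "wave k x = exp (freq k x)"

lemma bounded_linear_freq: "bounded_linear (freq k)"
  unfolding freq_def
  by (intro bounded_linear_intros bounded_linear_compose[OF bounded_linear_of_real]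
      bounded_linear_compose[OF bounded_linear_mult_right])

lemma freq_uminus: "freq (- k) v = - freq k v"
  by (simp add: freq_def algebra_simps)

lemma freq_add: "freq (j + k) v = freq j v + freq k v"
  by (simp add: freq_def algebra_simps)

lemma norm_freq_le: "norm (freq k v) \<le> 2 * pi * (\<bar>of_int (fst k)\<bar> + \<bar>of_int (snd k)\<bar>) * norm v"
proof -
  have "\<bar>fst v\<bar> \<le> norm v" "\<bar>snd v\<bar> \<le> norm v"
    using norm_fst_le[of "fst v" "snd v"] norm_snd_le[of "snd v" "fst v"] by simp_all
  then have "\<bar>of_int (fst k)\<bar> * \<bar>fst v\<bar> + \<bar>of_int (snd k)\<bar> * \<bar>snd v\<bar>
      \<le> \<bar>of_int (fst k)\<bar> * norm v + \<bar>of_int (snd k)\<bar> * norm v"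
    by (intro add_mono mult_left_mono) auto
  moreover have "\<bar>of_int (fst k) * fst v + of_int (snd k) * snd v\<bar>
      \<le> \<bar>of_int (fst k)\<bar> * \<bar>fst v\<bar> + \<bar>of_int (snd k)\<bar> * \<bar>snd v\<bar>"
    by (metis abs_mult abs_triangle_ineq)
  ultimately have le: "\<bar>of_int (fst k) * fst v + of_int (snd k) * snd v\<bar>
      \<le> (\<bar>of_int (fst k)\<bar> + \<bar>of_int (snd k)\<bar>) * norm v"
    by (simp add: distrib_right)
  have "norm (freq k v) = 2 * pi * \<bar>of_int (fst k) * fst v + of_int (snd k) * snd v\<bar>"
    unfolding freq_def norm_mult norm_ii norm_of_real by (simp add: abs_mult)
  also have "\<dots> \<le> 2 * pi * ((\<bar>of_int (fst k)\<bar> + \<bar>of_int (snd k)\<bar>) * norm v)"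
    using le by (intro mult_left_mono) auto
  finally show ?thesis
    by (simp add: mult.assoc)
qed

lemma wave_0 [simp]: "wave 0 x = 1"
  by (simp add: wave_def freq_def)

lemma wave_mult: "wave j x * wave k x = wave (j + k) x"
  by (simp add: wave_def freq_add exp_add)

lemma norm_wave [simp]: "norm (wave k x) = 1"
  by (simp add: wave_def freq_def)

lemma wave_cell_periodic: "cell_periodic (wave k)"
proof -
  have "wave k (x + v) = wave k x" if "\<exists>n. freq k v = (2 * of_int n * pi) * \<i>" for v x
  proof -
    have "freq k (x + v) = freq k x + freq k v"
      using bounded_linear_freq by (rule linear_add[OF bounded_linear.linear])
    moreover have "exp (freq k v) = 1"
      using that exp_integer_2pi[OF Ints_of_int] by force
    ultimately show ?thesis
      by (simp add: wave_def exp_add)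
  qed
  then have "wave k (x + (1, 0)) = wave k x" "wave k (x + (0, 1)) = wave k x" for x
    by (auto simp: freq_def intro!: exI[of _ "fst k"] exI[of _ "snd k"])
  then show ?thesis
    unfolding cell_periodic_def by blast
qed

lemma has_derivative_wave: "(wave k has_derivative (\<lambda>v. freq k v * wave k x)) (at x)"
proof -
  have "((\<lambda>x. exp (freq k x)) has_derivative (\<lambda>v. exp (freq k x) * freq k v)) (at x)"
    by (rule has_derivative_compose[OF bounded_linear_imp_has_derivative[OF bounded_linear_freq]
        DERIV_exp[unfolded has_field_derivative_def]])
  then show ?thesis
    by (simp add: wave_def[abs_def] mult.commute)
qed

lemma dderiv_wave: "dderiv v (wave k) = (\<lambda>x. freq k v * wave k x)"
  by (rule dderiv_eqI) (rule has_derivative_wave)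

lemma smooth_wave: "smooth (wave k)"
proof -
  have cont: "continuous_on UNIV (wave k)"
    by (rule has_derivative_continuous_on[OF has_derivative_at_withinI[OF has_derivative_wave]])
  have "times_differentiable m (\<lambda>x. c * wave k x)" for m c
  proof (induction m arbitrary: c)
    case 0
    show ?case
      using cont by (auto intro: continuous_intros)
  next
    case (Suc m)
    have "((\<lambda>x. c * wave k x) has_derivative (\<lambda>v. c * freq k v * wave k x)) (at x)" for x
      using has_derivative_mult_right[OF has_derivative_wave, of c] by (simp add: mult.assoc)
    then show ?case
      by (rule times_differentiable_SucI) (rule Suc)
  qed
  from this[of _ 1] show ?thesis
    by (simp add: smooth_def)
qed

lemma cell_integral_wave: "cell_integral (wave k) = (if k = 0 then 1 else 0)"
proof (cases "k = 0")
  case True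
  then show ?thesis
    using cell_integral_const[of 1] by (simp add: wave_0[abs_def])
next
  case False
  then have "fst k \<noteq> 0 \<or> snd k \<noteq> 0"
    by (auto simp: prod_eq_iff)
  then have "freq k (1, 0) \<noteq> 0 \<or> freq k (0, 1) \<noteq> 0"
    by (auto simp: freq_def)
  then obtain v where v: "v = (1, 0) \<or> v = (0, 1)" "freq k v \<noteq> 0"
    by blast
  have "freq k v * cell_integral (wave k) = 0"
    using cell_integral_dderiv[OF smooth_wave wave_cell_periodic v(1)]
    by (simp add: dderiv_wave cell_integral_cmult)
  with v False show ?thesis
    by simp
qed

section \<open>Fourier coefficients and their decay\<close>

definition fourier :: "(real \<times> real \<Rightarrow> complex) \<Rightarrow> int \<times> int \<Rightarrow> complex" where
  "fourier f k = cell_integral (\<lambda>x. f x * wave (- k) x)"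

lemma fourier_0: "fourier f 0 = cell_integral f"
  by (simp add: fourier_def)

lemma fourier_diff:
  assumes "continuous_on UNIV f" "continuous_on UNIV g"
  shows "fourier (\<lambda>x. f x - g x) k = fourier f k - fourier g k"
  unfolding fourier_def left_diff_distrib
  by (intro cell_integral_diff continuous_on_mult assms smooth_continuous_on smooth_wave)

lemma cell_periodic_mult:
  "cell_periodic f \<Longrightarrow> cell_periodic g \<Longrightarrow> cell_periodic (\<lambda>x. f x * g x)"
  unfolding cell_periodic_def by metis

text \<open>Integration by parts: the derivative of the periodic product of \<open>f\<close> and
  \<open>wave (- k)\<close> has mean zero.\<close>

lemma fourier_dderiv:
  assumes f: "smooth f" "cell_periodic f" and v: "v = (1, 0) \<or> v = (0, 1)"
  shows "fourier (dderiv v f) k = freq k v * fourier f k"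
proof -
  have cont: "continuous_on UNIV f" "continuous_on UNIV (dderiv v f)" "continuous_on UNIV (wave (- k))"
    by (intro smooth_continuous_on smooth_dderiv f smooth_wave)+
  have "0 = cell_integral (dderiv v (\<lambda>x. f x * wave (- k) x))"
    by (intro cell_integral_dderiv[symmetric] smooth_mult cell_periodic_mult f smooth_wave
        wave_cell_periodic v)
  also have "\<dots> = cell_integral (\<lambda>x. freq (- k) v * (f x * wave (- k) x) + dderiv v f x * wave (- k) x)"
    by (simp add: dderiv_mult f smooth_wave dderiv_wave mult_ac)
  also have "\<dots> = freq (- k) v * fourier f k + fourier (dderiv v f) k"
    unfolding fourier_def cell_integral_cmult[symmetric]
    by (intro cell_integral_add continuous_intros cont)
  finally show ?thesis
    by (simp add: freq_uminus)
qed

text \<open>Separate exponents for the two frequencies, rather than powers of a norm of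
  \<open>k\<close>, because one derivative in a coordinate direction pays for exactly one
  factor.\<close>

definition rapidly_decreasing :: "(int \<times> int \<Rightarrow> complex) \<Rightarrow> bool" where
  "rapidly_decreasing a \<longleftrightarrow>
     (\<forall>p q. \<exists>C. \<forall>k. \<bar>of_int (fst k)\<bar> ^ p * \<bar>of_int (snd k)\<bar> ^ q * norm (a k) \<le> C)"

text \<open>Each factor of a frequency is traded for a derivative of the function, up to 2 pi \<ge>
  1; what finally remains is the sup bound for a continuous function on the compact cell. The two
  exponents are removed by two nested inductions over all smooth periodic functions.\<close>

lemma rapidly_decreasing_fourier:
  assumes "smooth f" "cell_periodic f"
  shows "rapidly_decreasing (fourier f)"
proof -
  have step: "\<bar>x\<bar> * norm z \<le> norm (\<i> * complex_of_real (2 * pi * x) * z)" for x z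
  proof -
    have "1 \<le> 2 * pi"
      using pi_ge_two by linarith
    then have "1 * (\<bar>x\<bar> * norm z) \<le> 2 * pi * (\<bar>x\<bar> * norm z)"
      by (intro mult_right_mono) auto
    then show ?thesis
      by (simp add: norm_mult abs_mult mult.assoc)
  qed
  have base: "\<exists>C. \<forall>k. norm (fourier g k) \<le> C" if g: "smooth g" for g
  proof -
    have "compact (g ` cbox (0, 0) (1, 1))"
      by (intro compact_continuous_image smooth_continuous_on g compact_cbox)
    then obtain C where C: "\<forall>x\<in>cbox (0, 0) (1, 1). norm (g x) \<le> C"
      using compact_imp_bounded bounded_iff by (metis imageI)
    have "norm (fourier g k) \<le> C" for k
      unfolding fourier_def using C
      by (intro norm_cell_integral_le smooth_continuous_on smooth_mult g smooth_wave)
        (auto simp: norm_mult)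
    then show ?thesis
      by blast
  qed
  have snd: "\<exists>C. \<forall>k. \<bar>of_int (snd k)\<bar> ^ q * norm (fourier g k) \<le> C"
    if "smooth g" "cell_periodic g" for g q
    using that
  proof (induction q arbitrary: g)
    case 0
    then show ?case
      using base by simp
  next
    case (Suc q)
    from Suc.IH[OF smooth_dderiv cell_periodic_dderiv, OF Suc.prems(1) Suc.prems, of "(0, 1)"]
    obtain C where C: "\<bar>of_int (snd k)\<bar> ^ q * norm (fourier (dderiv (0, 1) g) k) \<le> C" for k
      by blast
    have "\<bar>of_int (snd k)\<bar> ^ Suc q * norm (fourier g k) \<le> C" for k
    proof -
      have "\<bar>of_int (snd k)\<bar> ^ q * (\<bar>of_int (snd k)\<bar> * norm (fourier g k))
          \<le> \<bar>of_int (snd k)\<bar> ^ q * norm (fourier (dderiv (0, 1) g) k)"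
        unfolding fourier_dderiv[OF Suc.prems disjI2[OF refl]] freq_def
        by (intro mult_left_mono) (use step[of "of_int (snd k)" "fourier g k"] in auto)
      with C[of k] show ?thesis
        by (simp add: mult_ac)
    qed
    then show ?case
      by blast
  qed
  have "\<exists>C. \<forall>k. \<bar>of_int (fst k)\<bar> ^ p * \<bar>of_int (snd k)\<bar> ^ q * norm (fourier g k) \<le> C"
    if "smooth g" "cell_periodic g" for g p q
    using that
  proof (induction p arbitrary: g)
    case 0
    then show ?case
      using snd by simp
  next
    case (Suc p)
    from Suc.IH[OF smooth_dderiv cell_periodic_dderiv, OF Suc.prems(1) Suc.prems, of "(1, 0)"]
    obtain C where C: "\<bar>of_int (fst k)\<bar> ^ p * \<bar>of_int (snd k)\<bar> ^ q *
        norm (fourier (dderiv (1, 0) g) k) \<le> C" for k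
      by blast
    have "\<bar>of_int (fst k)\<bar> ^ Suc p * \<bar>of_int (snd k)\<bar> ^ q * norm (fourier g k) \<le> C" for k
    proof -
      have "\<bar>of_int (fst k)\<bar> ^ p * \<bar>of_int (snd k)\<bar> ^ q * (\<bar>of_int (fst k)\<bar> * norm (fourier g k))
          \<le> \<bar>of_int (fst k)\<bar> ^ p * \<bar>of_int (snd k)\<bar> ^ q * norm (fourier (dderiv (1, 0) g) k)"
        unfolding fourier_dderiv[OF Suc.prems disjI1[OF refl]] freq_def
        by (intro mult_left_mono) (use step[of "of_int (fst k)" "fourier g k"] in auto)
      with C[of k] show ?thesis
        by (simp add: mult_ac)
    qed
    then show ?case
      by blast
  qed
  then show ?thesis
    unfolding rapidly_decreasing_def using assms by blast
qed

text \<open>The multiplier grows at most linearly in \<open>k\<close>, so two bounds with one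
  exponent raised by one suffice. This closure property is what lets termwise differentiation be
  iterated.\<close>

lemma rapidly_decreasing_mult_freq:
  assumes "rapidly_decreasing a"
  shows "rapidly_decreasing (\<lambda>k. a k * freq k v)"
  unfolding rapidly_decreasing_def
proof (intro allI)
  fix p q
  obtain C D where
    C: "\<And>k. \<bar>of_int (fst k)\<bar> ^ Suc p * \<bar>of_int (snd k)\<bar> ^ q * norm (a k) \<le> C" and
    D: "\<And>k. \<bar>of_int (fst k)\<bar> ^ p * \<bar>of_int (snd k)\<bar> ^ Suc q * norm (a k) \<le> D"
    using assms unfolding rapidly_decreasing_def by metis
  have "\<bar>of_int (fst k)\<bar> ^ p * \<bar>of_int (snd k)\<bar> ^ q * norm (a k * freq k v)
      \<le> 2 * pi * norm v * (C + D)" for k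
  proof -
    have "\<bar>of_int (fst k)\<bar> ^ p * \<bar>of_int (snd k)\<bar> ^ q * norm (a k * freq k v)
        \<le> \<bar>of_int (fst k)\<bar> ^ p * \<bar>of_int (snd k)\<bar> ^ q *
          (norm (a k) * (2 * pi * (\<bar>of_int (fst k)\<bar> + \<bar>of_int (snd k)\<bar>) * norm v))"
      unfolding norm_mult by (intro mult_left_mono norm_freq_le) auto
    also have "\<dots> = 2 * pi * norm v *
        (\<bar>of_int (fst k)\<bar> ^ Suc p * \<bar>of_int (snd k)\<bar> ^ q * norm (a k) +
         \<bar>of_int (fst k)\<bar> ^ p * \<bar>of_int (snd k)\<bar> ^ Suc q * norm (a k))"
      by (simp add: algebra_simps)
    also have "\<dots> \<le> 2 * pi * norm v * (C + D)"
      by (intro mult_left_mono add_mono C D) auto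
    finally show ?thesis .
  qed
  then show "\<exists>C. \<forall>k. \<bar>of_int (fst k)\<bar> ^ p * \<bar>of_int (snd k)\<bar> ^ q * norm (a k * freq k v) \<le> C"
    by blast
qed

text \<open>An enumeration of the frequency lattice, turning double series into ordinary ones to
  which the theorems on \<open>suminf\<close> and on termwise differentiation apply.\<close>

definition int_pair_enum :: "nat \<Rightarrow> int \<times> int" where
  "int_pair_enum n = map_prod int_decode int_decode (prod_decode n)"

lemma bij_int_pair_enum: "bij int_pair_enum"
proof -
  have "bij (map_prod int_decode int_decode)"
    using bij_int_decode by (simp add: bij_def prod.inj_map map_prod_surj)
  from bij_comp[OF bij_prod_decode this] show ?thesis
    by (simp add: int_pair_enum_def[abs_def] o_def)
qed

lemma summable_int_decode: "summable (\<lambda>n. 1 / (1 + (of_int (int_decode n))\<^sup>2) :: real)"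
proof (rule summable_comparison_test')
  show "summable (\<lambda>n. 8 * inverse (real (Suc n) ^ 2))"
    using inverse_power_summable[of 2, where 'a = real]
    by (intro summable_mult) (auto simp only: summable_Suc_iff[of "\<lambda>n. inverse (real n ^ 2)"])
  fix n :: nat
  define m where "m = n div 2"
  have "m \<le> \<bar>int_decode n\<bar>"
    by (auto simp: int_decode_def sum_decode_def m_def)
  then have "real m ^ 2 \<le> (real_of_int (int_decode n))\<^sup>2"
    by (metis abs_ge_zero abs_le_square_iff abs_of_nat of_int_abs of_int_le_iff of_int_of_nat_eq)
  then have m: "8 * (1 + real m ^ 2) \<le> 8 * (1 + (real_of_int (int_decode n))\<^sup>2)"
    by simp
  have "real (Suc n) \<le> 2 * (real m + 1)"
    by (simp add: m_def)
  then have "real (Suc n) ^ 2 \<le> (2 * (real m + 1))\<^sup>2"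
    by (rule power_mono) simp
  \<comment> \<open>The constant arises as 4 (m + 1)^2 \<le> 4 (2 m^2 + 2), by 2 m \<le> m^2 +
    1.\<close>
  also have "\<dots> \<le> 8 * (1 + real m ^ 2)"
    using sum_squares_bound[of "real m" 1] by (simp add: power2_eq_square algebra_simps)
  also note m
  finally have "real (Suc n) ^ 2 \<le> 8 * (1 + (real_of_int (int_decode n))\<^sup>2)" .
  moreover have "0 < 1 + (real_of_int (int_decode n))\<^sup>2"
    by (simp add: add_pos_nonneg)
  ultimately have "1 / (1 + (real_of_int (int_decode n))\<^sup>2) \<le> 8 * inverse (real (Suc n) ^ 2)"
    by (simp add: field_simps)
  with \<open>0 < 1 + (real_of_int (int_decode n))\<^sup>2\<close>
  show "norm (1 / (1 + (real_of_int (int_decode n))\<^sup>2)) \<le> 8 * inverse (real (Suc n) ^ 2)"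
    by simp
qed

lemma summable_prod_decode:
  fixes u v :: "nat \<Rightarrow> real"
  assumes "summable u" "summable v" "\<And>n. 0 \<le> u n" "\<And>n. 0 \<le> v n"
  shows "summable (\<lambda>n. u (fst (prod_decode n)) * v (snd (prod_decode n)))"
proof -
  have uv: "u summable_on UNIV" "v summable_on UNIV"
    using assms by (simp_all add: summable_on_UNIV_nonneg_real_iff)
  have "(\<lambda>x. norm (case x of (i, j) \<Rightarrow> u i * v j)) summable_on (UNIV \<times> UNIV)"
    unfolding Infinite_Sum.abs_summable_on_Sigma_iff
    using uv assms by (auto simp: abs_mult infsum_cmult_right' infsum_nonneg
        intro!: summable_on_cmult_right summable_on_cmult_left)
  then have "(\<lambda>x. u (fst x) * v (snd x)) summable_on UNIV"
    using summable_on_iff_abs_summable_on_real by (auto simp: case_prod_unfold)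
  then have "(\<lambda>n. u (fst (prod_decode n)) * v (snd (prod_decode n))) summable_on UNIV"
    using summable_on_reindex_bij_betw[OF bij_prod_decode, of "\<lambda>x. u (fst x) * v (snd x)"] by simp
  then show ?thesis
    by (rule summable_on_imp_summable)
qed

lemma rapidly_decreasing_summable:
  assumes "rapidly_decreasing a"
  shows "summable (\<lambda>n. norm (a (int_pair_enum n)))"
proof -
  obtain C where C: "\<And>p q k. p \<le> 2 \<Longrightarrow> q \<le> 2 \<Longrightarrow>
      \<bar>of_int (fst k)\<bar> ^ p * \<bar>of_int (snd k)\<bar> ^ q * norm (a k) \<le> C p q"
    using assms unfolding rapidly_decreasing_def by metis
  let ?g = "\<lambda>n. 1 / (1 + (of_int (int_decode n))\<^sup>2) :: real"
  \<comment> \<open>These are the four terms obtained by expanding (1 + k_1^2) (1 + k_2^2) times the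
    norm of \<open>a k\<close>.\<close>
  define B where "B = C 0 0 + C 2 0 + C 0 2 + C 2 2"
  have bound: "norm (a k) \<le> B * (1 / (1 + (of_int (fst k))\<^sup>2) * (1 / (1 + (of_int (snd k))\<^sup>2)))" for k
  proof -
    have "(1 + (of_int (fst k))\<^sup>2) * (1 + (of_int (snd k))\<^sup>2) * norm (a k) \<le> B"
      using C[of 0 0 k] C[of 2 0 k] C[of 0 2 k] C[of 2 2 k]
      by (simp add: B_def algebra_simps)
    moreover have "0 < (1 + (real_of_int (fst k))\<^sup>2) * (1 + (real_of_int (snd k))\<^sup>2)"
      by (intro mult_pos_pos add_pos_nonneg) auto
    ultimately show ?thesis
      by (simp add: field_simps)
  qed
  show ?thesis
  proof (rule summable_comparison_test')
    show "summable (\<lambda>n. B * (?g (fst (prod_decode n)) * ?g (snd (prod_decode n))))"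
      by (intro summable_mult summable_prod_decode summable_int_decode) auto
    show "norm (norm (a (int_pair_enum n))) \<le> B * (?g (fst (prod_decode n)) * ?g (snd (prod_decode n)))" for n
      using bound[of "int_pair_enum n"] by (simp add: int_pair_enum_def)
  qed
qed

section \<open>Fourier series: smoothness and coefficients\<close>

definition fseries :: "(int \<times> int \<Rightarrow> complex) \<Rightarrow> real \<times> real \<Rightarrow> complex" where
  "fseries a x = suminf (\<lambda>n. a (int_pair_enum n) * wave (int_pair_enum n) x)"

lemma fseries_sums:
  assumes "rapidly_decreasing a"
  shows "(\<lambda>n. a (int_pair_enum n) * wave (int_pair_enum n) x) sums fseries a x"
  unfolding fseries_def
  by (intro summable_sums summable_norm_cancel[OF summable_comparison_test'[OF rapidly_decreasing_summable[OF assms]]])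
    (auto simp: norm_mult)

lemma has_derivative_fseries:
  assumes a: "rapidly_decreasing a"
  shows "(fseries a has_derivative (\<lambda>v. fseries (\<lambda>k. a k * freq k v) x)) (at x)"
proof -
  let ?e = int_pair_enum
  \<comment> \<open>By linearity in the direction, the multipliers of the two coordinate directions
    dominate all others. Hence a single summable sequence controls the differentiated series
    uniformly in the point and in the direction.\<close>
  define b where "b n = norm (a (?e n) * freq (?e n) (1, 0)) + norm (a (?e n) * freq (?e n) (0, 1))" for n
  have b: "summable b"
    unfolding b_def by (intro summable_add rapidly_decreasing_summable rapidly_decreasing_mult_freq a)
  have le: "norm (a (?e n) * (freq (?e n) v * wave (?e n) y)) \<le> b n * norm v" for n v y
  proof -
    have "norm (freq (?e n) v) \<le> (norm (freq (?e n) (1, 0)) + norm (freq (?e n) (0, 1))) * norm v"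
      using norm_freq_le[of "?e n" v] by (simp add: freq_def norm_mult algebra_simps)
    then show ?thesis
      by (auto simp: b_def norm_mult mult.assoc simp flip: distrib_left intro: mult_left_mono)
  qed
  have "\<exists>g. \<forall>y\<in>UNIV. (\<lambda>n. a (?e n) * wave (?e n) y) sums g y \<and>
      (g has_derivative (\<lambda>v. fseries (\<lambda>k. a k * freq k v) y)) (at y within UNIV)"
  proof (rule has_derivative_series)
    show "((\<lambda>x. a (?e n) * wave (?e n) x) has_derivative (\<lambda>v. a (?e n) * (freq (?e n) v * wave (?e n) y)))
        (at y within UNIV)" for n y
      by (intro has_derivative_mult_right has_derivative_wave)
    show "\<forall>\<^sub>F n in sequentially. \<forall>y\<in>UNIV. \<forall>v.
        norm ((\<Sum>i<n. a (?e i) * (freq (?e i) v * wave (?e i) y)) - fseries (\<lambda>k. a k * freq k v) y)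
          \<le> e * norm v" if e: "e > 0" for e
    proof -
      obtain N where N: "\<And>n. n \<ge> N \<Longrightarrow> norm (suminf (\<lambda>i. b (i + n))) < e"
        using suminf_exist_split[OF e b] by blast
      have "norm ((\<Sum>i<n. a (?e i) * (freq (?e i) v * wave (?e i) y)) - fseries (\<lambda>k. a k * freq k v) y)
          \<le> e * norm v" if n: "n \<ge> N" for n y v
      proof -
        let ?f = "\<lambda>i. a (?e i) * (freq (?e i) v * wave (?e i) y)"
        have bn: "summable (\<lambda>i. b (i + n) * norm v)"
          by (intro summable_mult2 summable_ignore_initial_segment b)
        have f: "?f sums fseries (\<lambda>k. a k * freq k v) y"
          using fseries_sums[OF rapidly_decreasing_mult_freq[OF a]] by (simp add: mult.assoc)
        have "norm ((\<Sum>i<n. ?f i) - fseries (\<lambda>k. a k * freq k v) y) = norm (suminf (\<lambda>i. ?f (i + n)))"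
          using suminf_split_initial_segment[OF sums_summable[OF f], of n] sums_unique[OF f]
          by (simp add: norm_minus_commute)
        also have "\<dots> \<le> suminf (\<lambda>i. b (i + n) * norm v)"
          by (rule norm_suminf_le[OF le bn])
        also have "\<dots> = suminf (\<lambda>i. b (i + n)) * norm v"
          by (intro suminf_mult2[symmetric] summable_ignore_initial_segment b)
        also have "\<dots> \<le> e * norm v"
          using N[OF n] by (intro mult_right_mono) auto
        finally show ?thesis .
      qed
      then show ?thesis
        unfolding eventually_sequentially by blast
    qed
  qed (auto intro: fseries_sums[OF a])
  then obtain g where g: "\<And>y. (\<lambda>n. a (?e n) * wave (?e n) y) sums g y"
    "\<And>y. (g has_derivative (\<lambda>v. fseries (\<lambda>k. a k * freq k v) y)) (at y)"
    by auto
  have "g = fseries a"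
    using g(1) fseries_sums[OF a] sums_unique2 by blast
  with g(2) show ?thesis
    by blast
qed

lemma smooth_fseries:
  assumes "rapidly_decreasing a"
  shows "smooth (fseries a)"
proof -
  have "times_differentiable m (fseries a)" if "rapidly_decreasing a" for m a
    using that
  proof (induction m arbitrary: a)
    case 0
    then show ?case
      using has_derivative_continuous_on[OF has_derivative_at_withinI[OF has_derivative_fseries]]
      by (metis times_differentiable.simps(1))
  next
    case (Suc m)
    show ?case
      by (rule times_differentiable_SucI[OF has_derivative_fseries[OF Suc.prems]])
        (intro Suc.IH rapidly_decreasing_mult_freq Suc.prems)
  qed
  with assms show ?thesis
    by (simp add: smooth_def)
qed

lemma cell_periodic_fseries: "cell_periodic (fseries a)"
  using wave_cell_periodic unfolding cell_periodic_def fseries_def by simp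

text \<open>Uniform convergence permits integration term by term, and the waves are orthonormal. The
  integrals of the partial sums are therefore constant as soon as the index of \<open>k\<close> has
  been passed.\<close>

lemma fourier_fseries:
  assumes a: "rapidly_decreasing a"
  shows "fourier (fseries a) k = a k"
proof -
  let ?e = int_pair_enum
  let ?f = "\<lambda>n x. a (?e n) * wave (?e n) x * wave (- k) x"
  have lim: "uniform_limit (cbox (0, 0) (1, 1)) (\<lambda>n x. \<Sum>i<n. ?f i x) (\<lambda>x. suminf (\<lambda>i. ?f i x)) sequentially"
    by (rule Weierstrass_m_test[OF _ rapidly_decreasing_summable[OF a]]) (simp add: norm_mult)
  have "(\<lambda>x. suminf (\<lambda>i. ?f i x)) = (\<lambda>x. fseries a x * wave (- k) x)"
    using sums_unique[OF sums_mult2[OF fseries_sums[OF a]]] by (intro ext) simp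
  note lim = lim[unfolded this]
  have cont: "continuous_on S (?f n)" for n S
    by (intro continuous_intros smooth_continuous_on smooth_wave)
  obtain I J where IJ: "\<And>n. ((\<lambda>x. \<Sum>i<n. ?f i x) has_integral I n) (cbox (0, 0) (1, 1))"
    "((\<lambda>x. fseries a x * wave (- k) x) has_integral J) (cbox (0, 0) (1, 1))" "I \<longlonglongrightarrow> J"
    by (rule uniform_limit_integral_cbox[OF lim]) (auto intro: continuous_on_sum cont)
  have J: "fourier (fseries a) k = J"
    unfolding fourier_def cell_integral_def using IJ(2) by (rule integral_unique)
  obtain m where m: "?e m = k"
    using bij_int_pair_enum by (metis bij_pointE)
  have int_term: "cell_integral (?f i) = (if i = m then a k else 0)" for i
  proof -
    have "?e i = k \<longleftrightarrow> i = m"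
      using bij_int_pair_enum m by (metis bij_pointE)
    then show ?thesis
      by (simp add: mult.assoc wave_mult cell_integral_cmult cell_integral_wave[unfolded fun_eq_iff] m)
  qed
  have "I n = (\<Sum>i<n. if i = m then a k else 0)" for n
    using integral_unique[OF IJ(1)[of n], folded cell_integral_def]
    by (simp add: cell_integral_sum cont int_term)
  then have "\<forall>\<^sub>F n in sequentially. I n = a k"
    by (auto simp: eventually_sequentially intro!: exI[of _ "Suc m"])
  then have "I \<longlonglongrightarrow> a k"
    by (rule tendsto_eventually)
  with J IJ(3) show ?thesis
    using LIMSEQ_unique by blast
qed


section \<open>The periodic heat equation\<close>

lemma cell_periodic_frac:
  assumes "cell_periodic f"
  shows "f (frac (fst x), frac (snd x)) = f x"
proof -
  have shift: "f (y + of_int m *\<^sub>R v) = f y" if v: "\<And>y. f (y + v) = f y" for y v and m :: int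
  proof (induction m arbitrary: y rule: int_induct[where k = 0])
    case (step1 i)
    from step1.IH[of y] v[of "y + of_int i *\<^sub>R v"] show ?case
      by (simp add: algebra_simps)
  next
    case (step2 i)
    from step2.IH[of y] v[of "y + of_int (i - 1) *\<^sub>R v"] show ?case
      by (simp add: algebra_simps)
  qed simp
  have "f (y + (1, 0)) = f y" "f (y + (0, 1)) = f y" for y
    using assms unfolding cell_periodic_def by blast+
  note shift = shift[OF this(1)] shift[OF this(2)]
  have "x = (frac (fst x), frac (snd x)) + of_int \<lfloor>fst x\<rfloor> *\<^sub>R (1, 0) + of_int \<lfloor>snd x\<rfloor> *\<^sub>R (0, 1)"
    by (cases x) (simp add: frac_def)
  then show ?thesis
    by (metis shift)
qed

text \<open>The powers of \<open>K\<close> concentrate at the peak \<open>a\<close>: near \<open>a\<close> the kernel exceeds \<open>\<rho>'\<close>, while it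
  stays below some \<open>\<rho> < \<rho>'\<close> wherever \<open>h\<close> may be negative.\<close>

lemma nonpos_at_peak:
  fixes h K :: "real \<times> real \<Rightarrow> real"
  assumes h: "continuous_on UNIV h" and K: "continuous_on UNIV K"
    and K01: "\<And>x. 0 \<le> K x" "\<And>x. K x \<le> 1"
    and a: "a \<in> box (0, 0) (1, 1)" "K a = 1"
    and peak: "\<And>x. x \<in> cbox (0, 0) (1, 1) \<Longrightarrow> K x = 1 \<Longrightarrow> x = a"
    and zero: "\<And>n. cell_integral (\<lambda>x. h x * K x ^ n) = 0"
  shows "h a \<le> 0"
proof (rule ccontr)
  let ?C = "cbox (0, 0) (1::real, 1::real)"
  assume "\<not> h a \<le> 0"
  define c where "c = h a / 2"
  have c: "0 < c" "c < h a"
    using \<open>\<not> h a \<le> 0\<close> by (auto simp: c_def)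
  define W where "W = box (0, 0) (1, 1) \<inter> {x. c < h x}"
  have W: "open W" "a \<in> W"
    using a c unfolding W_def by (auto intro!: open_Int open_Collect_less h continuous_on_const)
  obtain \<rho> where \<rho>: "0 \<le> \<rho>" "\<rho> < 1" "\<And>x. x \<in> ?C - W \<Longrightarrow> K x \<le> \<rho>"
  proof (cases "?C - W = {}")
    case True
    then show ?thesis
      using that[of 0] by auto
  next
    case False
    have "compact (?C - W)"
      by (intro compact_diff compact_cbox W)
    from continuous_attains_sup[OF this False continuous_on_subset[OF K subset_UNIV]]
    obtain y where y: "y \<in> ?C - W" "\<And>x. x \<in> ?C - W \<Longrightarrow> K x \<le> K y"
      by blast
    then have "K y \<noteq> 1"
      using peak[of y] W by auto
    then show ?thesis
      using that[of "K y"] K01 y(2) by (metis less_eq_real_def)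
  qed
  define \<rho>' where "\<rho>' = (1 + \<rho>) / 2"
  have \<rho>': "\<rho> < \<rho>'" "\<rho>' < 1" "0 < \<rho>'"
    using \<rho> by (auto simp: \<rho>'_def)
  have "open (W \<inter> {x. \<rho>' < K x})" "a \<in> W \<inter> {x. \<rho>' < K x}"
    using W a \<rho>' by (auto intro!: open_Int open_Collect_less K continuous_on_const)
  then obtain p q where pq: "a \<in> box p q" "cbox p q \<subseteq> W \<inter> {x. \<rho>' < K x}"
    by (rule open_contains_cbox)
  have vol: "0 < measure lborel (cbox p q)"
    using pq(1) content_pos_lt_eq[of p q] box_ne_empty(2)[of p q] by blast
  have "compact (h ` ?C)"
    by (intro compact_continuous_image continuous_on_subset[OF h] compact_cbox) auto
  then obtain M where M: "\<And>x. x \<in> ?C \<Longrightarrow> \<bar>h x\<bar> \<le> M"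
    using compact_imp_bounded bounded_iff by (metis imageI real_norm_def)
  have sub: "cbox p q \<subseteq> ?C"
    using pq(2) box_subset_cbox unfolding W_def by blast
  have M0: "0 \<le> M"
    using M[of a] a(1) box_subset_cbox by fastforce
  have ineq: "c * measure lborel (cbox p q) * \<rho>' ^ n \<le> M * \<rho> ^ n" for n
  proof -
    \<comment> \<open>A step function below \<open>h * K ^ n\<close>: on the small box both factors
      are bounded below, elsewhere in \<open>W\<close> the product is nonnegative, and outside
      \<open>W\<close> it is at least - M \<rho>^n. Subtracting that bound on the whole cell, which
      has volume one, costs nothing that matters.\<close>
    let ?g = "\<lambda>x. (if x \<in> cbox p q then c * \<rho>' ^ n else 0) - M * \<rho> ^ n"
    have "(?g has_integral measure lborel (cbox p q) *\<^sub>R (c * \<rho>' ^ n) - measure lborel ?C *\<^sub>R (M * \<rho> ^ n)) ?C"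
      by (intro has_integral_diff has_integral_const)
        (subst has_integral_restrict[OF sub], rule has_integral_const)
    moreover have "((\<lambda>x. h x * K x ^ n) has_integral cell_integral (\<lambda>x. h x * K x ^ n)) ?C"
      unfolding cell_integral_def
      by (intro integrable_integral cell_integrable continuous_intros h K)
    moreover have "?g x \<le> h x * K x ^ n" if x: "x \<in> ?C" for x
    proof (cases "x \<in> W")
      case True
      have 0: "0 \<le> M * \<rho> ^ n"
        using M0 \<rho>(1) by simp
      have hx: "c < h x"
        using True by (simp add: W_def)
      show ?thesis
      proof (cases "x \<in> cbox p q")
        case True
        have "\<rho>' ^ n \<le> K x ^ n"
          using True pq(2) \<rho>'(3) by (intro power_mono) auto
        then have "c * \<rho>' ^ n \<le> h x * K x ^ n"
          using hx c(1) \<rho>'(3) by (intro mult_mono) auto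
        with 0 True show ?thesis
          by simp
      next
        case False
        have "0 \<le> h x * K x ^ n"
          using hx c(1) K01 by simp
        with 0 False show ?thesis
          by simp
      qed
    next
      case False
      then have "K x ^ n \<le> \<rho> ^ n"
        using \<rho>(3) x K01 by (intro power_mono) auto
      then have "\<bar>h x * K x ^ n\<bar> \<le> M * \<rho> ^ n"
        unfolding abs_mult using M[OF x] K01 M0 by (intro mult_mono) auto
      then show ?thesis
        using False pq(2) by auto
    qed
    ultimately have "measure lborel (cbox p q) *\<^sub>R (c * \<rho>' ^ n) - measure lborel ?C *\<^sub>R (M * \<rho> ^ n)
        \<le> cell_integral (\<lambda>x. h x * K x ^ n)"
      by (rule has_integral_le)
    then show ?thesis
      by (simp add: zero content_Pair mult_ac)
  qed
  \<comment> \<open>After division by \<rho>'^n a fixed positive number would be bounded by a null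
    sequence.\<close>
  have "(\<lambda>n. M * (\<rho> / \<rho>') ^ n) \<longlonglongrightarrow> M * 0"
    using \<rho>(1) \<rho>' by (intro tendsto_mult tendsto_const LIMSEQ_power_zero) auto
  moreover have "c * measure lborel (cbox p q) \<le> M * (\<rho> / \<rho>') ^ n" for n
    using ineq[of n] \<rho>'(3) by (simp add: power_divide pos_le_divide_eq)
  ultimately have "c * measure lborel (cbox p q) \<le> 0"
    by (intro LIMSEQ_le_const[of _ "M * 0", simplified]) auto
  with vol c(1) show False
    by (simp add: mult_le_0_iff)
qed

text \<open>A trigonometric polynomial with values in [0, 1], equal to 1 exactly where k . (x - a)
  is an integer. The product of the ones for \<open>(1, 0)\<close> and \<open>(0, 1)\<close> is the
  peaked kernel.\<close>

definition raised_cosine :: "int \<times> int \<Rightarrow> real \<times> real \<Rightarrow> real \<times> real \<Rightarrow> real" where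
  "raised_cosine k a x = (1 + cos (Im (freq k (x - a)))) / 2"

lemma continuous_raised_cosine: "continuous_on UNIV (raised_cosine k a)"
  unfolding raised_cosine_def freq_def by (simp add: continuous_intros)

lemma raised_cosine_bounds: "0 \<le> raised_cosine k a x" "raised_cosine k a x \<le> 1"
proof -
  have "0 \<le> 1 + cos (Im (freq k (x - a)))" "1 + cos (Im (freq k (x - a))) \<le> 2"
    using cos_ge_minus_one[of "Im (freq k (x - a))"] by linarith simp
  then show "0 \<le> raised_cosine k a x" "raised_cosine k a x \<le> 1"
    by (auto simp: raised_cosine_def)
qed

lemma of_real_raised_cosine:
  "complex_of_real (raised_cosine k a x) =
     1 / 2 + wave k (- a) / 4 * wave k x + wave (- k) (- a) / 4 * wave (- k) x"
proof -
  have wave_diff: "wave j (x - a) = wave j (- a) * wave j x" for j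
  proof -
    have "freq j (- a + x) = freq j (- a) + freq j x"
      using bounded_linear_freq by (rule linear_add[OF bounded_linear.linear])
    then show ?thesis
      by (simp add: wave_def exp_add)
  qed
  have "freq k (x - a) = \<i> * complex_of_real (Im (freq k (x - a)))"
    by (simp add: freq_def)
  then have "complex_of_real (cos (Im (freq k (x - a)))) = (wave k (x - a) + wave (- k) (x - a)) / 2"
    unfolding wave_def freq_uminus cos_of_real[symmetric] cos_exp_eq by metis
  then show ?thesis
    by (simp add: raised_cosine_def wave_diff add_divide_distrib algebra_simps)
qed

text \<open>The kernel is a combination of the frequencies 0 and \<plusminus>j, so multiplying by it
  merely mixes Fourier coefficients, all of which vanish. Iteration covers every power of the
  kernel.\<close>

lemma cell_integral_raised_cosine:
  assumes f: "continuous_on UNIV f" and zero: "\<And>k. cell_integral (\<lambda>x. f x * wave k x) = 0"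
  shows "cell_integral (\<lambda>x. f x * complex_of_real (raised_cosine j a x) * wave k x) = 0"
proof -
  have "(\<lambda>x. f x * complex_of_real (raised_cosine j a x) * wave k x) =
      (\<lambda>x. 1 / 2 * (f x * wave k x) + wave j (- a) / 4 * (f x * wave (j + k) x)
        + wave (- j) (- a) / 4 * (f x * wave (- j + k) x))"
    unfolding of_real_raised_cosine wave_mult[symmetric] by (simp add: algebra_simps)
  then show ?thesis
    by (simp only: cell_integral_add cell_integral_cmult zero continuous_on_add continuous_on_mult
        continuous_on_const f smooth_continuous_on smooth_wave) simp
qed

text \<open>For h = Re (cnj (f a) f) all moments against powers of the kernel vanish, so
  \<open>nonpos_at_peak\<close> gives |f a|^2 = h a \<le> 0. The peak \<open>a\<close> is taken in
  the open cell, since a boundary point would have a translate in the closed cell where the kernel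
  also equals 1; continuity and periodicity then reach all other points.\<close>

lemma fourier_eq_0_imp_eq_0:
  assumes f: "continuous_on UNIV f" "cell_periodic f" and zero: "\<And>k. fourier f k = 0"
  shows "f = (\<lambda>_. 0)"
proof -
  have box: "f a = 0" if a: "a \<in> box (0, 0) (1, 1)" for a
  proof -
    define K where "K x = raised_cosine (1, 0) a x * raised_cosine (0, 1) a x" for x
    have contK: "continuous_on UNIV K"
      unfolding K_def by (intro continuous_on_mult continuous_raised_cosine)
    have "cell_integral (\<lambda>x. f x * complex_of_real (K x) ^ n * wave k x) = 0" for n k
    proof (induction n arbitrary: k)
      case 0
      show ?case
        using zero[of "- k"] by (simp add: fourier_def)
    next
      case (Suc n)
      have "cell_integral (\<lambda>x. (f x * complex_of_real (K x) ^ n * complex_of_real (raised_cosine (1, 0) a x))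
          * complex_of_real (raised_cosine (0, 1) a x) * wave k x) = 0"
        by (intro cell_integral_raised_cosine Suc.IH continuous_intros f contK continuous_raised_cosine)
      then show ?case
        by (simp add: K_def mult_ac)
    qed
    from this[of _ 0] have fK: "cell_integral (\<lambda>x. f x * complex_of_real (K x) ^ n) = 0" for n
      by simp
    define h where "h x = Re (cnj (f a) * f x)" for x
    have "h a \<le> 0"
    proof (rule nonpos_at_peak[OF _ contK])
      show "continuous_on UNIV h"
        unfolding h_def by (intro continuous_intros f)
      show "0 \<le> K x" "K x \<le> 1" for x
        unfolding K_def by (intro mult_nonneg_nonneg mult_le_one raised_cosine_bounds)+
      show "K a = 1"
        by (simp add: K_def raised_cosine_def freq_def)
      show "x = a" if x: "x \<in> cbox (0, 0) (1, 1)" "K x = 1" for x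
      proof -
        have "1 \<le> raised_cosine (1, 0) a x" "1 \<le> raised_cosine (0, 1) a x"
          unfolding x(2)[symmetric] K_def
          by (rule mult_left_le mult_left_le_one_le raised_cosine_bounds)+
        then have "raised_cosine (1, 0) a x = 1" "raised_cosine (0, 1) a x = 1"
          by (simp_all add: antisym raised_cosine_bounds)
        then have "cos (2 * pi * (fst x - fst a)) = 1" "cos (2 * pi * (snd x - snd a)) = 1"
          by (auto simp: raised_cosine_def freq_def)
        then obtain m n :: int where "fst x - fst a = m" "snd x - snd a = n"
          by (auto simp: cos_one_2pi_int)
        moreover have "\<bar>fst x - fst a\<bar> < 1" "\<bar>snd x - snd a\<bar> < 1"
          using x(1) a by (cases a; auto simp: cbox_Pair_eq mem_box Basis_prod_def abs_less_iff)+
        ultimately have "\<bar>m\<bar> < 1 \<and> \<bar>n\<bar> < 1"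
          by (simp flip: of_int_abs)
        then have "m = 0 \<and> n = 0"
          by simp
        with \<open>fst x - fst a = m\<close> \<open>snd x - snd a = n\<close> show ?thesis
          by (auto simp: prod_eq_iff)
      qed
      show "cell_integral (\<lambda>x. h x * K x ^ n) = 0" for n
      proof -
        have "cell_integral (\<lambda>x. Re (cnj (f a) * (f x * complex_of_real (K x) ^ n)))
            = Re (cell_integral (\<lambda>x. cnj (f a) * (f x * complex_of_real (K x) ^ n)))"
          by (intro cell_integral_bounded_linear bounded_linear_Re continuous_intros f contK)
        also have "\<dots> = 0"
          by (simp only: cell_integral_cmult fK) simp
        finally show ?thesis
          by (simp add: h_def mult.assoc[symmetric] flip: of_real_power)
      qed
    qed (use a in auto)
    then show ?thesis
      by (auto simp: h_def complex_eq_iff not_sum_power2_lt_zero sum_power2_le_zero_iff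
          simp flip: power2_eq_square)
  qed
  have "f x = 0" if "x \<in> cbox (0, 0) (1, 1)" for x
  proof -
    have "x \<in> closure (box (0, 0) (1, 1))"
      using that by (subst closure_box) (auto simp: box_ne_empty Basis_prod_def)
    then show ?thesis
      by (rule continuous_constant_on_closure[OF continuous_on_subset[OF f(1)] box, rotated -1]) auto
  qed
  from this[of "(frac (fst x), frac (snd x))" for x] show ?thesis
    using cell_periodic_frac[OF f(2)]
    by (auto simp: cbox_Pair_eq frac_lt_1 less_imp_le)
qed

section \<open>The heat operator and its Fourier multiplier\<close>

definition heat :: "(real \<times> real \<Rightarrow> 'b::real_normed_vector) \<Rightarrow> real \<times> real \<Rightarrow> 'b" where
  "heat u x = dderiv (0, 1) u x - dderiv (1, 0) (dderiv (1, 0) u) x"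

definition heat_symbol :: "int \<times> int \<Rightarrow> complex" where
  "heat_symbol k = freq k (0, 1) - (freq k (1, 0))\<^sup>2"

text \<open>Real and imaginary part are (2 pi k_1)^2 and 2 pi k_2; a nonzero integer frequency makes
  one of them at least one in absolute value.\<close>

lemma norm_heat_symbol_ge_1:
  assumes "k \<noteq> 0"
  shows "1 \<le> norm (heat_symbol k)"
proof -
  have *: "1 \<le> \<bar>real_of_int m\<bar> * r" if "m \<noteq> 0" "1 \<le> r" for m :: int and r
  proof -
    have "1 * 1 \<le> \<bar>real_of_int m\<bar> * r"
      using that by (intro mult_mono) linarith+
    then show ?thesis
      by simp
  qed
  have pi: "1 \<le> 2 * pi"
    using pi_ge_two by linarith
  have eq: "heat_symbol k = Complex ((2 * pi * of_int (fst k))\<^sup>2) (2 * pi * of_int (snd k))"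
    by (auto simp: heat_symbol_def freq_def complex_eq_iff power2_eq_square)
  consider "fst k \<noteq> 0" | "snd k \<noteq> 0"
    using assms by (auto simp: prod_eq_iff)
  then show ?thesis
  proof cases
    case 1
    have "1 \<le> \<bar>2 * pi * real_of_int (fst k)\<bar>"
      using *[OF 1 pi] by (simp add: abs_mult mult_ac)
    then have "1 \<le> \<bar>Re (heat_symbol k)\<bar>"
      by (simp add: eq) (metis one_le_power power2_abs)
    then show ?thesis
      using abs_Re_le_cmod order_trans by blast
  next
    case 2
    have "1 \<le> \<bar>Im (heat_symbol k)\<bar>"
      using *[OF 2 pi] by (simp add: eq abs_mult mult_ac)
    then show ?thesis
      using abs_Im_le_cmod order_trans by blast
  qed
qed

lemma fourier_heat:
  assumes "smooth u" "cell_periodic u"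
  shows "fourier (heat u) k = heat_symbol k * fourier u k"
proof -
  note d = smooth_dderiv[OF assms(1)] cell_periodic_dderiv[OF assms]
  have "fourier (heat u) k = fourier (dderiv (0, 1) u) k - fourier (dderiv (1, 0) (dderiv (1, 0) u)) k"
    unfolding heat_def by (intro fourier_diff smooth_continuous_on smooth_dderiv assms)
  also have "fourier (dderiv (1, 0) (dderiv (1, 0) u)) k = freq k (1, 0) * (freq k (1, 0) * fourier u k)"
    by (simp add: fourier_dderiv assms d)
  finally show ?thesis
    by (simp add: fourier_dderiv assms heat_symbol_def power2_eq_square algebra_simps)
qed

lemma cell_periodic_diff:
  "cell_periodic f \<Longrightarrow> cell_periodic g \<Longrightarrow> cell_periodic (\<lambda>x. f x - g x)"
  unfolding cell_periodic_def by metis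

lemma smooth_heat: "smooth u \<Longrightarrow> smooth (heat u)"
  unfolding heat_def by (intro smooth_diff smooth_dderiv)

lemma cell_periodic_heat: "smooth u \<Longrightarrow> cell_periodic u \<Longrightarrow> cell_periodic (heat u)"
  unfolding heat_def by (intro cell_periodic_diff cell_periodic_dderiv smooth_dderiv)

lemma cell_periodic_compose: "cell_periodic f \<Longrightarrow> cell_periodic (\<lambda>x. g (f x))"
  unfolding cell_periodic_def by metis

lemma heat_solution:
  fixes f :: "real \<times> real \<Rightarrow> real"
  assumes f: "smooth f" "cell_periodic f" and mean: "cell_integral f = 0"
  obtains u :: "real \<times> real \<Rightarrow> real"
    where "smooth u" "cell_periodic u" "cell_integral u = 0" "heat u = f"
proof -
  define F where "F x = complex_of_real (f x)" for x
  have F: "smooth F" "cell_periodic F"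
    unfolding F_def by (rule smooth_of_real[OF f(1)], rule cell_periodic_compose[OF f(2)])
  \<comment> \<open>The symbol vanishes at frequency 0, but so does the coefficient of
    \<open>F\<close>, because its mean is zero. The quotient is then 0 as well, which fixes the mean
    of the solution.\<close>
  define b where "b k = fourier F k / heat_symbol k" for k
  have F0: "fourier F 0 = 0"
    using cell_integral_bounded_linear[OF bounded_linear_of_real[where 'a = complex] smooth_continuous_on[OF f(1)]]
    by (simp add: fourier_0 F_def[abs_def] mean)
  have bF: "heat_symbol k * b k = fourier F k" for k
    using norm_heat_symbol_ge_1[of k] F0 by (cases "k = 0") (auto simp: b_def)
  have "norm (b k) \<le> norm (fourier F k)" for k
  proof (cases "k = 0")
    case True
    then show ?thesis
      by (simp add: b_def F0)
  next
    case False
    then have "1 * norm (b k) \<le> norm (heat_symbol k) * norm (b k)"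
      by (intro mult_right_mono norm_heat_symbol_ge_1) auto
    then show ?thesis
      by (simp flip: norm_mult add: bF)
  qed
  note b_le = this
  have "rapidly_decreasing b"
    unfolding rapidly_decreasing_def
  proof (intro allI)
    fix p q
    obtain C where C: "\<bar>of_int (fst k)\<bar> ^ p * \<bar>of_int (snd k)\<bar> ^ q * norm (fourier F k) \<le> C" for k
      using rapidly_decreasing_fourier[OF F] unfolding rapidly_decreasing_def by blast
    have "\<bar>of_int (fst k)\<bar> ^ p * \<bar>of_int (snd k)\<bar> ^ q * norm (b k) \<le> C" for k
      by (rule order_trans[OF mult_left_mono[OF b_le] C]) simp
    then show "\<exists>C. \<forall>k. \<bar>of_int (fst k)\<bar> ^ p * \<bar>of_int (snd k)\<bar> ^ q * norm (b k) \<le> C"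
      by blast
  qed
  note b = smooth_fseries[OF this] cell_periodic_fseries fourier_fseries[OF this]
  have cont: "continuous_on UNIV (fseries b)"
    by (intro smooth_continuous_on b)
  have contF: "continuous_on UNIV F" "continuous_on UNIV (heat (fseries b))"
    by (intro smooth_continuous_on smooth_heat F b)+
  \<comment> \<open>The equation is checked on Fourier coefficients only; uniqueness turns this into
    a pointwise identity.\<close>
  have "(\<lambda>x. heat (fseries b) x - F x) = (\<lambda>_. 0)"
  proof (rule fourier_eq_0_imp_eq_0)
    show "continuous_on UNIV (\<lambda>x. heat (fseries b) x - F x)"
      by (intro continuous_intros contF)
    show "cell_periodic (\<lambda>x. heat (fseries b) x - F x)"
      by (intro cell_periodic_diff cell_periodic_heat F b)
    show "fourier (\<lambda>x. heat (fseries b) x - F x) k = 0" for k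
      by (simp add: fourier_diff contF fourier_heat b bF)
  qed
  from fun_cong[OF this] have heat: "heat (fseries b) x = F x" for x
    by simp
  show ?thesis
  proof
    show "smooth (\<lambda>x. Re (fseries b x))" "cell_periodic (\<lambda>x. Re (fseries b x))"
      by (rule smooth_Re[OF b(1)], rule cell_periodic_compose[OF b(2)])
    have "cell_integral (fseries b) = 0"
      using b(3)[of 0] F0 by (simp add: fourier_0 b_def)
    then show "cell_integral (\<lambda>x. Re (fseries b x)) = 0"
      by (simp add: cell_integral_bounded_linear[OF bounded_linear_Re cont])
    have "heat (\<lambda>x. Re (fseries b x)) x = Re (heat (fseries b) x)" for x
      by (simp add: heat_def dderiv_Re smooth_dderiv b)
    then show "heat (\<lambda>x. Re (fseries b x)) = f"
      by (simp add: heat F_def fun_eq_iff)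
  qed
qed

lemma heat_unique:
  fixes u :: "real \<times> real \<Rightarrow> real"
  assumes u: "smooth u" "cell_periodic u" and "cell_integral u = 0" "heat u = (\<lambda>_. 0)"
  shows "u = (\<lambda>_. 0)"
proof -
  define U where "U x = complex_of_real (u x)" for x
  have U: "smooth U" "cell_periodic U"
    unfolding U_def by (rule smooth_of_real[OF u(1)], rule cell_periodic_compose[OF u(2)])
  have "heat U x = complex_of_real (heat u x)" for x
    by (simp add: heat_def U_def[abs_def] dderiv_of_real smooth_dderiv u)
  then have "fourier (heat U) k = 0" for k
    using cell_integral_const[of 0] by (simp add: assms(4) fourier_def)
  then have "heat_symbol k * fourier U k = 0" for k
    by (simp add: fourier_heat U)
  moreover have "fourier U 0 = 0"
    using cell_integral_bounded_linear[OF bounded_linear_of_real[where 'a = complex] smooth_continuous_on[OF u(1)]]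
    by (simp add: fourier_0 U_def[abs_def] assms(3))
  ultimately have "fourier U k = 0" for k
    using norm_heat_symbol_ge_1[of k] by (metis mult_eq_0_iff norm_zero not_one_le_zero)
  then have "U = (\<lambda>_. 0)"
    by (rule fourier_eq_0_imp_eq_0[OF smooth_continuous_on[OF U(1)] U(2)])
  then have "U x = 0" for x
    by simp
  then show ?thesis
    by (auto simp: U_def)
qed


section \<open>Polynomials with periodic coefficients\<close>

text \<open>Unlike in \<open>is_ycoeffs\<close>, the exponent set is fixed in advance and
  coefficients on it may vanish. This makes closure under sums immediate, and the set itself records
  a degree bound.\<close>

definition ppoly ::
    "(nat \<times> nat) set \<Rightarrow> (real \<times> real \<Rightarrow> real \<times> real \<Rightarrow> real) \<Rightarrow> bool" where
  "ppoly S U \<longleftrightarrow> (\<exists>c. (\<forall>n. smooth (c n) \<and> cell_periodic (c n)) \<and>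
     U = (\<lambda>x y. \<Sum>n\<in>S. c n x * ymon y n))"

text \<open>The bound is strict so that \<open>below 0\<close> is empty and leaves only the zero
  polynomial, the base of the induction on the degree; degree at most \<open>N\<close> is expressed
  by \<open>below (Suc N)\<close>.\<close>

definition below :: "nat \<Rightarrow> (nat \<times> nat) set" where
  "below N = {n. pnorm n < N}"

lemma finite_below [simp]: "finite (below N)"
proof (rule finite_subset)
  show "below N \<subseteq> {..N} \<times> {..N}"
    by (auto simp: below_def pnorm_def)
qed simp

lemma mem_below_iff [simp]: "n \<in> below N \<longleftrightarrow> pnorm n < N"
  by (simp add: below_def)

lemma below_mono: "M \<le> N \<Longrightarrow> below M \<subseteq> below N"
  by (auto simp: below_def)

lemma cell_periodic_const: "cell_periodic (\<lambda>_. c)"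
  unfolding cell_periodic_def by simp

lemma cell_periodic_add:
  "cell_periodic f \<Longrightarrow> cell_periodic g \<Longrightarrow> cell_periodic (\<lambda>x. f x + g x)"
  unfolding cell_periodic_def by simp

lemma ppolyE:
  assumes "ppoly S U"
  obtains c where "\<And>n. smooth (c n)" "\<And>n. cell_periodic (c n)"
    "U = (\<lambda>x y. \<Sum>n\<in>S. c n x * ymon y n)"
proof -
  from assms obtain c where c: "\<forall>n. smooth (c n) \<and> cell_periodic (c n)"
      "U = (\<lambda>x y. \<Sum>n\<in>S. c n x * ymon y n)"
    unfolding ppoly_def by (elim exE conjE)
  show ?thesis
    by (rule that[OF conjunct1[OF spec[OF c(1)]] conjunct2[OF spec[OF c(1)]] c(2)])
qed

lemma ppolyI:
  assumes "\<And>n. smooth (c n)" "\<And>n. cell_periodic (c n)"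
  shows "ppoly S (\<lambda>x y. \<Sum>n\<in>S. c n x * ymon y n)"
  unfolding ppoly_def using assms by (intro exI[of _ c]) simp

lemma ppoly_mono:
  assumes "finite T" "S \<subseteq> T" "ppoly S U"
  shows "ppoly T U"
proof -
  from assms(3) obtain c where c: "\<And>n. smooth (c n)" "\<And>n. cell_periodic (c n)"
    and U: "U = (\<lambda>x y. \<Sum>n\<in>S. c n x * ymon y n)"
    by (rule ppolyE) (rule that)
  define d where "d n = (if n \<in> S then c n else (\<lambda>_. 0))" for n
  have "U = (\<lambda>x y. \<Sum>n\<in>T. d n x * ymon y n)"
    unfolding U using assms by (intro ext sum.mono_neutral_cong_left) (auto simp: d_def)
  then show ?thesis
    using ppolyI[of d T] c by (simp add: d_def smooth_const cell_periodic_const)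
qed

lemma ppoly_below_mono: "ppoly (below M) U \<Longrightarrow> M \<le> N \<Longrightarrow> ppoly (below N) U"
  using ppoly_mono[OF finite_below below_mono] by blast

lemma ppoly_zero: "ppoly S (\<lambda>x y. 0)"
  using ppolyI[of "\<lambda>_ _. 0" S] by (simp add: smooth_const cell_periodic_const)

lemma ppoly_add:
  assumes "ppoly S U" "ppoly S V"
  shows "ppoly S (\<lambda>x y. U x y + V x y)"
proof -
  from assms(1) obtain c where c: "\<And>n. smooth (c n)" "\<And>n. cell_periodic (c n)"
    and U: "U = (\<lambda>x y. \<Sum>n\<in>S. c n x * ymon y n)"
    by (rule ppolyE) (rule that)
  from assms(2) obtain d where d: "\<And>n. smooth (d n)" "\<And>n. cell_periodic (d n)"
    and V: "V = (\<lambda>x y. \<Sum>n\<in>S. d n x * ymon y n)"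
    by (rule ppolyE) (rule that)
  have "ppoly S (\<lambda>x y. \<Sum>n\<in>S. (c n x + d n x) * ymon y n)"
    by (intro ppolyI smooth_add cell_periodic_add c d)
  then show ?thesis
    by (simp add: U V distrib_right sum.distrib)
qed

lemma ppoly_cmult:
  assumes "ppoly S U"
  shows "ppoly S (\<lambda>x y. r * U x y)"
proof -
  from assms obtain c where c: "\<And>n. smooth (c n)" "\<And>n. cell_periodic (c n)"
    and U: "U = (\<lambda>x y. \<Sum>n\<in>S. c n x * ymon y n)"
    by (rule ppolyE) (rule that)
  have "ppoly S (\<lambda>x y. \<Sum>n\<in>S. (r * c n x) * ymon y n)"
    by (intro ppolyI smooth_cmult cell_periodic_mult cell_periodic_const c)
  then show ?thesis
    by (simp add: U sum_distrib_left mult.assoc)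
qed

lemma ppoly_diff:
  assumes "ppoly S U" "ppoly S V"
  shows "ppoly S (\<lambda>x y. U x y - V x y)"
  using ppoly_add[OF assms(1) ppoly_cmult[OF assms(2), of "- 1"]] by simp

lemma ppoly_sum:
  "(\<And>i. i \<in> I \<Longrightarrow> ppoly S (U i)) \<Longrightarrow> ppoly S (\<lambda>x y. \<Sum>i\<in>I. U i x y)"
  by (induction I rule: infinite_finite_induct) (auto intro: ppoly_zero ppoly_add)

lemma ppoly_monomial:
  assumes "finite S" "n \<in> S" "smooth c" "cell_periodic c"
  shows "ppoly S (\<lambda>x y. c x * ymon y n)"
proof -
  have "ppoly {n} (\<lambda>x y. \<Sum>n\<in>{n}. c x * ymon y n)"
    by (rule ppolyI) (rule assms)+
  then show ?thesis
    using assms by (intro ppoly_mono[of S "{n}"]) auto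
qed

lemma ymon_mult: "ymon y m * ymon y n = ymon y (m + n)"
  by (simp add: ymon_def power_add mult_ac)

lemma pnorm_add: "pnorm (m + n) = pnorm m + pnorm n"
  by (simp add: pnorm_def)

lemma ppoly_mult:
  assumes "ppoly (below (Suc M)) U" "ppoly (below (Suc N)) V"
  shows "ppoly (below (Suc (M + N))) (\<lambda>x y. U x y * V x y)"
proof -
  from assms(1) obtain c where c: "\<And>n. smooth (c n)" "\<And>n. cell_periodic (c n)"
    and U: "U = (\<lambda>x y. \<Sum>n\<in>below (Suc M). c n x * ymon y n)"
    by (rule ppolyE) (rule that)
  from assms(2) obtain d where d: "\<And>n. smooth (d n)" "\<And>n. cell_periodic (d n)"
    and V: "V = (\<lambda>x y. \<Sum>n\<in>below (Suc N). d n x * ymon y n)"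
    by (rule ppolyE) (rule that)
  have eq: "(\<lambda>x y. U x y * V x y) =
      (\<lambda>x y. \<Sum>m\<in>below (Suc M). \<Sum>n\<in>below (Suc N). (c m x * d n x) * ymon y (m + n))"
    by (simp add: U V sum_product mult_ac flip: ymon_mult)
  show ?thesis
    unfolding eq
    by (intro ppoly_sum ppoly_monomial finite_below smooth_mult cell_periodic_mult c d)
      (auto simp: pnorm_add)
qed

lemma is_ycoeffs_ppoly:
  assumes "finite S"
  shows "is_ycoeffs (\<lambda>x y. \<Sum>n\<in>S. c n x * ymon y n) (\<lambda>n. if n \<in> S then c n else (\<lambda>_. 0))"
proof -
  have sub: "{n. (if n \<in> S then c n else (\<lambda>_. 0)) \<noteq> (\<lambda>_. 0)} \<subseteq> S"
    by auto
  then show ?thesis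
    unfolding is_ycoeffs_def using assms
    by (auto intro!: sum.mono_neutral_cong_right simp: finite_subset)
qed

lemma ppoly_coeffs_eq_0:
  fixes a :: "nat \<times> nat \<Rightarrow> real"
  assumes "finite S" "\<And>y. (\<Sum>n\<in>S. a n * ymon y n) = 0" "n \<in> S"
  shows "a n = 0"
proof -
  have "is_ycoeffs (\<lambda>x y. \<Sum>n\<in>S. a n * ymon y n) (\<lambda>n. if n \<in> S then (\<lambda>_. a n) else (\<lambda>_. 0))"
    by (rule is_ycoeffs_ppoly[OF assms(1)])
  moreover have "is_ycoeffs (\<lambda>x y. \<Sum>n\<in>S. a n * ymon y n) (\<lambda>n _. 0)"
    by (simp add: assms(2) is_ycoeffs_def)
  ultimately have "(\<lambda>n. if n \<in> S then (\<lambda>_::real \<times> real. a n) else (\<lambda>_. 0)) = (\<lambda>n _. 0)"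
    by (rule is_ycoeffs_unique)
  from fun_cong[OF fun_cong[OF this, of n], of 0] assms(3) show ?thesis
    by simp
qed

lemma periodic_polynomial_iff: "periodic_polynomial U \<longleftrightarrow> (\<exists>N. ppoly (below N) U)"
proof
  assume "periodic_polynomial U"
  then obtain c where c: "is_ycoeffs U c" "\<And>n. smooth (c n)" "\<And>n. cell_periodic (c n)"
    unfolding periodic_polynomial_def periodic_iff_cell_periodic by blast
  let ?S = "{n. c n \<noteq> (\<lambda>_. 0)}"
  have S: "finite ?S" "U = (\<lambda>x y. \<Sum>n\<in>?S. c n x * ymon y n)"
    using c(1) unfolding is_ycoeffs_def by (blast, intro ext, blast)
  define N where "N = Suc (Max (insert 0 (pnorm ` ?S)))"
  have "?S \<subseteq> below N"
    using S(1) unfolding N_def below_def by (auto simp: less_Suc_eq_le intro!: Max_ge)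
  moreover have "ppoly ?S U"
    using S(2) ppolyI[OF c(2,3)] by simp
  ultimately show "\<exists>N. ppoly (below N) U"
    using ppoly_mono[OF finite_below] by blast
next
  assume "\<exists>N. ppoly (below N) U"
  then obtain N where "ppoly (below N) U" ..
  then obtain c where c: "\<And>n. smooth (c n)" "\<And>n. cell_periodic (c n)"
    and U: "U = (\<lambda>x y. \<Sum>n\<in>below N. c n x * ymon y n)"
    by (rule ppolyE) (rule that)
  show "periodic_polynomial U"
    unfolding periodic_polynomial_def periodic_iff_cell_periodic U
    by (rule exI, rule conjI, rule is_ycoeffs_ppoly) (auto simp: c smooth_const cell_periodic_const)
qed

lemma pdeg_le:
  assumes "ppoly (below (Suc N)) U"
  shows "pdeg U \<le> ereal (real N)"
proof (cases "U = (\<lambda>_ _. 0)")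
  case False
  from assms obtain c where c: "\<And>n. smooth (c n)" "\<And>n. cell_periodic (c n)"
    and U: "U = (\<lambda>x y. \<Sum>n\<in>below (Suc N). c n x * ymon y n)"
    by (rule ppolyE) (rule that)
  have Uc: "is_ycoeffs U (\<lambda>n. if n \<in> below (Suc N) then c n else (\<lambda>_. 0))"
    unfolding U by (rule is_ycoeffs_ppoly) simp
  let ?D = "{pnorm n | n. ycoeffs U n \<noteq> (\<lambda>_. 0)}"
  have le: "?D \<subseteq> {..N}"
    unfolding ycoeffs_eqI[OF Uc] by auto
  have "?D \<noteq> {}"
  proof
    assume "?D = {}"
    then have "{n. ycoeffs U n \<noteq> (\<lambda>_. 0)} = {}"
      by blast
    with Uc have "U x y = 0" for x y
      unfolding ycoeffs_eqI[OF Uc] is_ycoeffs_def by (metis (no_types, lifting) sum.empty)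
    with False show False
      by blast
  qed
  then have "Max ?D \<le> N"
    using le by (intro Max.boundedI finite_subset[OF le]) auto
  with False show ?thesis
    by (simp add: pdeg_def)
qed (simp add: pdeg_def)

section \<open>The lifted derivatives on polynomials with periodic coefficients\<close>

definition dd :: "real \<times> real \<Rightarrow> (real \<times> real \<Rightarrow> real \<times> real \<Rightarrow> real)
    \<Rightarrow> real \<times> real \<Rightarrow> real \<times> real \<Rightarrow> real" where
  "dd v U x y = deriv (\<lambda>t. U (x + t *\<^sub>R v) y) 0 + deriv (\<lambda>t. U x (y + t *\<^sub>R v)) 0"

lemma component_DD: "component (DD v \<Phi>) \<beta> = dd v (component \<Phi> \<beta>)"
  by (simp add: component_def DD_def pd_def dd_def fun_eq_iff)

text \<open>The derivative of a monomial in direction \<open>v\<close>. Truncated subtraction is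
  harmless: where an exponent is 0, the factor in front vanishes.\<close>

definition dymon :: "real \<times> real \<Rightarrow> nat \<times> nat \<Rightarrow> real \<times> real \<Rightarrow> real" where
  "dymon v n y = fst v * real (fst n) * ymon y (fst n - 1, snd n)
     + snd v * real (snd n) * ymon y (fst n, snd n - 1)"

lemma has_derivative_ymon_line:
  "((\<lambda>t. ymon (y + t *\<^sub>R v) n) has_real_derivative dymon v n y) (at 0)"
  unfolding ymon_def dymon_def by (auto intro!: derivative_eq_intros)

lemma ppoly_derivatives:
  assumes "\<And>n. smooth (c n)"
  shows "((\<lambda>t. \<Sum>n\<in>S. c n (x + t *\<^sub>R v) * ymon y n) has_real_derivative
      (\<Sum>n\<in>S. dderiv v (c n) x * ymon y n)) (at 0)"
    and "((\<lambda>t. \<Sum>n\<in>S. c n x * ymon (y + t *\<^sub>R v) n) has_real_derivative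
      (\<Sum>n\<in>S. c n x * dymon v n y)) (at 0)"
  by (intro DERIV_sum DERIV_cmult DERIV_cmult_right smooth_has_real_derivative_line assms
      has_derivative_ymon_line)+

lemma dd_ppoly:
  assumes "\<And>n. smooth (c n)"
  shows "dd v (\<lambda>x y. \<Sum>n\<in>S. c n x * ymon y n) =
    (\<lambda>x y. \<Sum>n\<in>S. dderiv v (c n) x * ymon y n + c n x * dymon v n y)"
  by (simp add: dd_def fun_eq_iff sum.distrib ppoly_derivatives[OF assms, THEN DERIV_imp_deriv])

lemma ppoly_differentiable:
  assumes "ppoly S U"
  shows "(\<lambda>t. U (x + t *\<^sub>R v) y) field_differentiable at 0"
    and "(\<lambda>t. U x (y + t *\<^sub>R v)) field_differentiable at 0"
proof -
  from assms obtain c where c: "\<And>n. smooth (c n)" "\<And>n. cell_periodic (c n)"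
    and U: "U = (\<lambda>x y. \<Sum>n\<in>S. c n x * ymon y n)"
    by (rule ppolyE) (rule that)
  show "(\<lambda>t. U (x + t *\<^sub>R v) y) field_differentiable at 0"
    "(\<lambda>t. U x (y + t *\<^sub>R v)) field_differentiable at 0"
    unfolding U field_differentiable_def
    by (rule exI, rule ppoly_derivatives, rule c)+
qed

lemma dd_add:
  assumes "ppoly S U" "ppoly S V"
  shows "dd v (\<lambda>x y. U x y + V x y) = (\<lambda>x y. dd v U x y + dd v V x y)"
  by (simp add: dd_def fun_eq_iff ppoly_differentiable[OF assms(1)] ppoly_differentiable[OF assms(2)])

lemma dd_diff:
  assumes "ppoly S U" "ppoly S V"
  shows "dd v (\<lambda>x y. U x y - V x y) = (\<lambda>x y. dd v U x y - dd v V x y)"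
  by (simp add: dd_def fun_eq_iff ppoly_differentiable[OF assms(1)] ppoly_differentiable[OF assms(2)])

lemma dd_zero: "dd v (\<lambda>x y. 0) = (\<lambda>x y. 0)"
  by (simp add: dd_def fun_eq_iff)

lemma dd_monomial:
  assumes "smooth c"
  shows "dd v (\<lambda>x y. c x * ymon y n) =
    (\<lambda>x y. dderiv v c x * ymon y n + c x * dymon v n y)"
  using dd_ppoly[of "\<lambda>_. c" v "{n}"] assms by simp

lemma ppoly_monomial_dymon:
  assumes "smooth c" "cell_periodic c"
  shows "ppoly (below (pnorm n)) (\<lambda>x y. c x * dymon v n y)"
proof -
  have 1: "ppoly (below (pnorm n)) (\<lambda>x y. real (fst n) * (c x * ymon y (fst n - 1, snd n)))"
    by (cases "fst n = 0", simp add: ppoly_zero)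
      (intro ppoly_cmult ppoly_monomial finite_below assms, auto simp: pnorm_def)
  have 2: "ppoly (below (pnorm n)) (\<lambda>x y. real (snd n) * (c x * ymon y (fst n, snd n - 1)))"
    by (cases "snd n = 0", simp add: ppoly_zero)
      (intro ppoly_cmult ppoly_monomial finite_below assms, auto simp: pnorm_def)
  from ppoly_add[OF ppoly_cmult[OF 1, of "fst v"] ppoly_cmult[OF 2, of "snd v"]] show ?thesis
    by (simp add: dymon_def algebra_simps)
qed

lemma ppoly_dd:
  assumes "ppoly (below N) U"
  shows "ppoly (below N) (dd v U)"
proof -
  from assms obtain c where c: "\<And>n. smooth (c n)" "\<And>n. cell_periodic (c n)"
    and U: "U = (\<lambda>x y. \<Sum>n\<in>below N. c n x * ymon y n)"
    by (rule ppolyE) (rule that)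
  have "ppoly (below N) (\<lambda>x y. c n x * dymon v n y)" if "n \<in> below N" for n
    using that by (intro ppoly_below_mono[OF ppoly_monomial_dymon] c) auto
  then show ?thesis
    unfolding U dd_ppoly[of c, OF c(1)]
    by (intro ppoly_sum ppoly_add ppoly_monomial finite_below smooth_dderiv cell_periodic_dderiv c)
qed

definition lifted_heat :: "(real \<times> real \<Rightarrow> real \<times> real \<Rightarrow> real)
    \<Rightarrow> real \<times> real \<Rightarrow> real \<times> real \<Rightarrow> real" where
  "lifted_heat U x y = dd (0, 1) U x y - dd (1, 0) (dd (1, 0) U) x y"

lemma lifted_heat_zero: "lifted_heat (\<lambda>x y. 0) = (\<lambda>x y. 0)"
  by (simp add: lifted_heat_def dd_zero fun_eq_iff)

lemma lifted_heat_add: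
  assumes "ppoly (below N) U" "ppoly (below N) V"
  shows "lifted_heat (\<lambda>x y. U x y + V x y) = (\<lambda>x y. lifted_heat U x y + lifted_heat V x y)"
  unfolding lifted_heat_def dd_add[OF assms] dd_add[OF ppoly_dd ppoly_dd, OF assms]
  by (simp add: fun_eq_iff)

lemma lifted_heat_diff:
  assumes "ppoly (below N) U" "ppoly (below N) V"
  shows "lifted_heat (\<lambda>x y. U x y - V x y) = (\<lambda>x y. lifted_heat U x y - lifted_heat V x y)"
  unfolding lifted_heat_def dd_diff[OF assms] dd_diff[OF ppoly_dd ppoly_dd, OF assms]
  by (simp add: fun_eq_iff)

lemma lifted_heat_sum:
  assumes "\<And>i. i \<in> I \<Longrightarrow> ppoly (below N) (U i)"
  shows "lifted_heat (\<lambda>x y. \<Sum>i\<in>I. U i x y) = (\<lambda>x y. \<Sum>i\<in>I. lifted_heat (U i) x y)"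
  using assms
proof (induction I rule: infinite_finite_induct)
  case (insert i I)
  have "lifted_heat (\<lambda>x y. U i x y + (\<Sum>i\<in>I. U i x y)) =
      (\<lambda>x y. lifted_heat (U i) x y + lifted_heat (\<lambda>x y. \<Sum>i\<in>I. U i x y) x y)"
    using insert.prems by (intro lifted_heat_add ppoly_sum) auto
  with insert show ?case
    by simp
qed (simp_all add: lifted_heat_zero)

text \<open>The part of (D_2 - D_1^2) (c y^n) in which at least one derivative falls on y^n; each
  such derivative lowers the parabolic degree.\<close>

definition heat_remainder :: "(real \<times> real \<Rightarrow> real) \<Rightarrow> nat \<times> nat
    \<Rightarrow> real \<times> real \<Rightarrow> real \<times> real \<Rightarrow> real" where
  "heat_remainder c n = (\<lambda>x y. c x * dymon (0, 1) n y
     - (dderiv (1, 0) c x * dymon (1, 0) n y + dd (1, 0) (\<lambda>x y. c x * dymon (1, 0) n y) x y))"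

lemma ppoly_heat_remainder:
  assumes c: "smooth c" "cell_periodic c"
  shows "ppoly (below (pnorm n)) (heat_remainder c n)"
  unfolding heat_remainder_def
  by (intro ppoly_diff ppoly_add ppoly_dd ppoly_monomial_dymon c smooth_dderiv cell_periodic_dderiv)

lemma lifted_heat_monomial:
  assumes c: "smooth c" "cell_periodic c"
  shows "lifted_heat (\<lambda>x y. c x * ymon y n) = (\<lambda>x y. heat c x * ymon y n + heat_remainder c n x y)"
proof -
  let ?e1 = "(1, 0) :: real \<times> real"
  note c1 = smooth_dderiv[OF c(1), of ?e1] cell_periodic_dderiv[OF c, of ?e1]
  have "dd ?e1 (\<lambda>x y. dderiv ?e1 c x * ymon y n + c x * dymon ?e1 n y) =
      (\<lambda>x y. dd ?e1 (\<lambda>x y. dderiv ?e1 c x * ymon y n) x y + dd ?e1 (\<lambda>x y. c x * dymon ?e1 n y) x y)"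
    by (rule dd_add[of "below (Suc (pnorm n))"])
      (auto intro!: ppoly_monomial ppoly_below_mono[OF ppoly_monomial_dymon] c c1)
  note split = this
  show ?thesis
    unfolding lifted_heat_def heat_remainder_def heat_def dd_monomial[OF c(1)] split
      dd_monomial[OF c1(1)]
    by (simp add: fun_eq_iff left_diff_distrib)
qed

section \<open>Averages over the periodic variable\<close>

definition xmean :: "(real \<times> real \<Rightarrow> real \<times> real \<Rightarrow> real) \<Rightarrow> real \<times> real \<Rightarrow> real" where
  "xmean U y = cell_integral (\<lambda>x. U x y)"

lemma xmean_ppoly:
  assumes "\<And>n. smooth (c n)"
  shows "xmean (\<lambda>x y. \<Sum>n\<in>S. c n x * ymon y n) y = (\<Sum>n\<in>S. cell_integral (c n) * ymon y n)"
  unfolding xmean_def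
  by (simp add: cell_integral_sum continuous_on_mult_right smooth_continuous_on assms
      cell_integral_mult_const)

lemma ppoly_continuous_on:
  assumes "ppoly S U"
  shows "continuous_on UNIV (\<lambda>x. U x y)"
proof -
  from assms obtain c where c: "\<And>n. smooth (c n)" "\<And>n. cell_periodic (c n)"
    and U: "U = (\<lambda>x y. \<Sum>n\<in>S. c n x * ymon y n)"
    by (rule ppolyE) (rule that)
  show ?thesis
    unfolding U by (intro continuous_intros smooth_continuous_on c)
qed

lemma xmean_add:
  assumes "ppoly S U" "ppoly S V"
  shows "xmean (\<lambda>x y. U x y + V x y) y = xmean U y + xmean V y"
  unfolding xmean_def by (intro cell_integral_add ppoly_continuous_on[OF assms(1)] ppoly_continuous_on[OF assms(2)])

lemma xmean_diff:
  assumes "ppoly S U" "ppoly S V"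
  shows "xmean (\<lambda>x y. U x y - V x y) y = xmean U y - xmean V y"
  unfolding xmean_def by (intro cell_integral_diff ppoly_continuous_on[OF assms(1)] ppoly_continuous_on[OF assms(2)])

text \<open>The x-derivative of each coefficient integrates to zero, so only the derivative in y
  survives the average.\<close>

lemma xmean_dd:
  assumes "ppoly S U" and v: "v = (1, 0) \<or> v = (0, 1)"
  shows "xmean (dd v U) y = deriv (\<lambda>t. xmean U (y + t *\<^sub>R v)) 0"
proof -
  from assms(1) obtain c where c: "\<And>n. smooth (c n)" "\<And>n. cell_periodic (c n)"
    and U: "U = (\<lambda>x y. \<Sum>n\<in>S. c n x * ymon y n)"
    by (rule ppolyE) (rule that)
  have cont: "continuous_on T (c n)" "continuous_on T (dderiv v (c n))" for n T
    by (intro smooth_continuous_on smooth_dderiv c)+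
  have "((\<lambda>t. xmean U (y + t *\<^sub>R v)) has_real_derivative
      (\<Sum>n\<in>S. cell_integral (c n) * dymon v n y)) (at 0)"
    unfolding U xmean_ppoly[of c, OF c(1)] by (intro DERIV_sum DERIV_cmult has_derivative_ymon_line)
  moreover have "xmean (dd v U) y = (\<Sum>n\<in>S. cell_integral (c n) * dymon v n y)"
    unfolding U dd_ppoly[of c, OF c(1)] xmean_def
    by (simp add: cell_integral_sum cell_integral_add continuous_intros cont
        cell_integral_mult_const cell_integral_dderiv[OF c v])
  ultimately show ?thesis
    by (simp add: DERIV_imp_deriv)
qed

lemma xmean_lifted_heat:
  assumes U: "ppoly (below N) U"
  shows "xmean (lifted_heat U) y = deriv (\<lambda>t. xmean U (y + t *\<^sub>R (0, 1))) 0
    - deriv (\<lambda>s. deriv (\<lambda>t. xmean U (y + s *\<^sub>R (1, 0) + t *\<^sub>R (1, 0))) 0) 0"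
proof -
  have "xmean (lifted_heat U) y = xmean (dd (0, 1) U) y - xmean (dd (1, 0) (dd (1, 0) U)) y"
    unfolding lifted_heat_def by (rule xmean_diff[OF ppoly_dd ppoly_dd[OF ppoly_dd]]) (rule U)+
  then show ?thesis
    by (simp add: xmean_dd[OF U] xmean_dd[OF ppoly_dd[OF U]])
qed

section \<open>Existence and uniqueness for the linear problem\<close>

lemma real_polynomial_function_ymon: "real_polynomial_function (\<lambda>y. ymon y n)"
  unfolding ymon_def
  by (intro real_polynomial_function.intros(4) real_polynomial_function_power
      real_polynomial_function.intros(1) bounded_linear_fst bounded_linear_snd)

lemma lifted_heat_solution:
  assumes "ppoly (below N) F"
  shows "\<exists>U P. ppoly (below N) U \<and> (\<forall>y. xmean U y = 0) \<and> real_polynomial_function P \<and>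
    (\<forall>x y. lifted_heat U x y + P y = F x y)"
  using assms
proof (induction N arbitrary: F rule: less_induct)
  case (less N)
  let ?solvable = "\<lambda>F. \<exists>U P. ppoly (below N) U \<and> (\<forall>y. xmean U y = 0) \<and> real_polynomial_function P \<and>
    (\<forall>x y. lifted_heat U x y + P y = F x y)"
  have mono: "?solvable (\<lambda>x y. c x * ymon y n)"
    if c: "smooth c" "cell_periodic c" and n: "n \<in> below N" for c n
  proof -
    have cont: "continuous_on UNIV c"
      by (intro smooth_continuous_on c)
    \<comment> \<open>Only the mean-free part of \<open>c\<close> lies in the range of the heat
      operator; the mean times the monomial goes into the polynomial in y.\<close>
    have "cell_integral (\<lambda>x. c x - cell_integral c) = cell_integral c - cell_integral c"
      using cell_integral_diff[OF cont continuous_on_const] by simp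
    then have "cell_integral (\<lambda>x. c x - cell_integral c) = 0"
      by simp
    with smooth_diff[OF c(1) smooth_const] cell_periodic_diff[OF c(2) cell_periodic_const]
    obtain u where u: "smooth u" "cell_periodic u" "cell_integral u = 0"
      "heat u = (\<lambda>x. c x - cell_integral c)"
      by (rule heat_solution) (rule that)
    define R where "R = heat_remainder u n"
    have R: "ppoly (below (pnorm n)) R"
        "lifted_heat (\<lambda>x y. u x * ymon y n) = (\<lambda>x y. heat u x * ymon y n + R x y)"
      unfolding R_def by (rule ppoly_heat_remainder[OF u(1,2)], rule lifted_heat_monomial[OF u(1,2)])
    have lt: "pnorm n < N"
      using n by (simp add: below_def)
    from less.IH[OF lt R(1)] obtain V Q where V: "ppoly (below (pnorm n)) V" "\<And>y. xmean V y = 0"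
      and Q: "real_polynomial_function Q" "\<And>x y. lifted_heat V x y + Q y = R x y"
      by blast
    have V': "ppoly (below N) V"
      using ppoly_below_mono[OF V(1)] lt by simp
    have u': "ppoly (below N) (\<lambda>x y. u x * ymon y n)"
      by (intro ppoly_monomial finite_below n u)
    \<comment> \<open>\<open>V\<close> cancels the remainder up to a polynomial: the operator sends
      \<open>?U\<close> to (c - mean c) y^n + R - (R - Q), and \<open>?P\<close> supplies mean c y^n
      - Q.\<close>
    let ?U = "\<lambda>x y. u x * ymon y n - V x y" and ?P = "\<lambda>y. cell_integral c * ymon y n - Q y"
    have "ppoly (below N) ?U"
      by (intro ppoly_diff u' V')
    moreover have "xmean ?U y = 0" for y
      unfolding xmean_diff[OF u' V'] using u(3) V(2) by (simp add: xmean_def cell_integral_mult_const)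
    moreover have "real_polynomial_function ?P"
      by (intro real_polynomial_function_diff real_polynomial_function.intros(2,4)
          real_polynomial_function_ymon Q)
    moreover have "lifted_heat ?U x y + ?P y = c x * ymon y n" for x y
      using Q(2)[of x y] by (simp add: lifted_heat_diff[OF u' V'] R(2) u(4) algebra_simps)
    ultimately show ?thesis
      by blast
  qed
  have add: "?solvable (\<lambda>x y. F x y + G x y)" if "?solvable F" "?solvable G" for F G
  proof -
    from that obtain U P V Q where U: "ppoly (below N) U" "\<And>y. xmean U y = 0"
      and P: "real_polynomial_function P" "\<And>x y. lifted_heat U x y + P y = F x y"
      and V: "ppoly (below N) V" "\<And>y. xmean V y = 0"
      and Q: "real_polynomial_function Q" "\<And>x y. lifted_heat V x y + Q y = G x y"
      by blast
    let ?U = "\<lambda>x y. U x y + V x y" and ?P = "\<lambda>y. P y + Q y"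
    have "ppoly (below N) ?U"
      by (intro ppoly_add U V)
    moreover have "xmean ?U y = 0" for y
      by (simp add: xmean_add[OF U(1) V(1)] U V)
    moreover have "real_polynomial_function ?P"
      by (intro real_polynomial_function.intros(3) P Q)
    moreover have "lifted_heat ?U x y + ?P y = F x y + G x y" for x y
      by (simp add: lifted_heat_add[OF U(1) V(1)] flip: P(2) Q(2))
    ultimately show ?thesis
      by blast
  qed
  have "?solvable (\<lambda>x y. 0)"
    by (intro exI[of _ "\<lambda>x y. 0"] exI[of _ "\<lambda>y. 0"])
      (simp add: ppoly_zero xmean_def lifted_heat_zero real_polynomial_function.intros(2))
  from less.prems obtain c where c: "\<And>n. smooth (c n)" "\<And>n. cell_periodic (c n)"
    and F: "F = (\<lambda>x y. \<Sum>n\<in>below N. c n x * ymon y n)"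
    by (rule ppolyE) (rule that)
  have "?solvable (\<lambda>x y. \<Sum>n\<in>S. c n x * ymon y n)" if "finite S" "S \<subseteq> below N" for S
    using that
  proof (induction S rule: finite_induct)
    case empty
    then show ?case
      using \<open>?solvable (\<lambda>x y. 0)\<close> by simp
  next
    case (insert n S)
    then show ?case
      using add[OF mono[OF c] insert.IH] by simp
  qed
  then show ?case
    unfolding F by simp
qed

text \<open>The coefficients of top parabolic degree solve the homogeneous periodic heat equation
  and have mean zero, hence vanish. The degree drops by one and the hypotheses persist.\<close>

lemma lifted_heat_eq_0:
  assumes "ppoly (below N) U" "\<And>y. xmean U y = 0" "lifted_heat U = (\<lambda>x y. 0)"
  shows "U = (\<lambda>x y. 0)"
  using assms
proof (induction N arbitrary: U)
  case 0
  then show ?case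
    by (auto elim!: ppolyE simp: below_def)
next
  case (Suc N)
  from Suc.prems(1) obtain c where c: "\<And>n. smooth (c n)" "\<And>n. cell_periodic (c n)"
    and U: "U = (\<lambda>x y. \<Sum>n\<in>below (Suc N). c n x * ymon y n)"
    by (rule ppolyE) (rule that)
  let ?top = "{n. pnorm n = N}"
  have mean: "cell_integral (c n) = 0" if "n \<in> below (Suc N)" for n
    by (rule ppoly_coeffs_eq_0[OF finite_below _ that])
      (use Suc.prems(2) in \<open>simp add: U xmean_ppoly[of c, OF c(1)]\<close>)
  define R' where "R' x y = (\<Sum>n\<in>below (Suc N). heat_remainder (c n) n x y)" for x y
  \<comment> \<open>All remainders lie strictly below degree \<open>N\<close>, so they do not
    disturb the coefficients with \<open>pnorm n = N\<close>.\<close>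
  have "ppoly (below N) R'"
    unfolding R'_def
    by (intro ppoly_sum ppoly_below_mono[OF ppoly_heat_remainder] c) auto
  then obtain r where "\<And>n. smooth (r n)" "\<And>n. cell_periodic (r n)" and r: "R' = (\<lambda>x y. \<Sum>n\<in>below N. r n x * ymon y n)"
    by (rule ppolyE) (rule that)
  have Heq: "lifted_heat U x y =
      (\<Sum>n\<in>below (Suc N). (heat (c n) x + (if n \<in> below N then r n x else 0)) * ymon y n)" for x y
  proof -
    have "lifted_heat U x y = (\<Sum>n\<in>below (Suc N). lifted_heat (\<lambda>x y. c n x * ymon y n) x y)"
      unfolding U by (subst lifted_heat_sum) (auto intro!: ppoly_monomial c)
    also have "\<dots> = (\<Sum>n\<in>below (Suc N). heat (c n) x * ymon y n) + R' x y"
      by (simp add: lifted_heat_monomial c sum.distrib R'_def)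
    also have "R' x y = (\<Sum>n\<in>below (Suc N). (if n \<in> below N then r n x else 0) * ymon y n)"
      unfolding r using below_mono[of N "Suc N"] by (intro sum.mono_neutral_cong_left) auto
    finally show ?thesis
      by (simp add: sum.distrib distrib_right)
  qed
  have "c n = (\<lambda>_. 0)" if n: "n \<in> below (Suc N)" "n \<notin> below N" for n
  proof (rule heat_unique[OF c mean[OF n(1)]])
    have "heat (c n) x + (if n \<in> below N then r n x else 0) = 0" for x
      by (rule ppoly_coeffs_eq_0[OF finite_below _ n(1)]) (simp only: Heq[symmetric] Suc.prems(3))
    with n(2) show "heat (c n) = (\<lambda>_. 0)"
      by auto
  qed
  then have "U = (\<lambda>x y. \<Sum>n\<in>below N. c n x * ymon y n)"
    unfolding U using below_mono[of N "Suc N"]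
    by (intro ext sum.mono_neutral_cong_right) auto
  then have "ppoly (below N) U"
    using ppolyI[OF c] by simp
  then show ?case
    by (rule Suc.IH) (rule Suc.prems)+
qed

text \<open>The difference of the two solutions has mean zero for every y, hence so does its image
  under the operator. That image is \<open>Q - P\<close>, independent of x, so it equals its own
  mean. Since \<open>P\<close> and \<open>Q\<close> may be any functions of y, later arguments can
  compare a solution with an explicit candidate.\<close>

lemma lifted_heat_unique:
  assumes U: "periodic_polynomial U" and V: "periodic_polynomial V"
    and mean: "\<And>y. xmean U y = xmean V y"
    and eq: "\<And>x y. lifted_heat U x y + P y = lifted_heat V x y + Q y"
  shows "U = V \<and> P = Q"
proof -
  from U V obtain M N where "ppoly (below M) U" "ppoly (below N) V"
    unfolding periodic_polynomial_iff by blast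
  then have UV: "ppoly (below (max M N)) U" "ppoly (below (max M N)) V"
    using ppoly_below_mono by (metis max.cobounded1, metis max.cobounded2)
  let ?W = "\<lambda>x y. U x y - V x y"
  have W: "ppoly (below (max M N)) ?W"
    by (intro ppoly_diff UV)
  have mean0: "xmean ?W y = 0" for y
    by (simp add: xmean_diff[OF UV] mean)
  have heat: "lifted_heat ?W = (\<lambda>x y. Q y - P y)"
  proof (intro ext)
    show "lifted_heat ?W x y = Q y - P y" for x y
      using eq[of x y] by (simp add: lifted_heat_diff[OF UV])
  qed
  have "Q y - P y = 0" for y
    using xmean_lifted_heat[OF W, of y] unfolding heat mean0 by (simp add: xmean_def)
  then have "P = Q" "lifted_heat ?W = (\<lambda>x y. 0)"
    unfolding heat by auto
  moreover from lifted_heat_eq_0[OF W mean0 this(2)] have "U x y = V x y" for x y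
    by (metis eq_iff_diff_eq_0)
  ultimately show ?thesis
    by blast
qed


section \<open>Solving the system component by component\<close>

declare One_nat_def [simp del]

section \<open>Total degree, parabolic weight and bracket of multi-indices\<close>

definition msize :: "mindex \<Rightarrow> nat" where
  "msize \<beta> = Sum_any (Poly_Mapping.lookup \<beta>)"

lemma finite_lookup_inj:
  fixes \<beta> :: mindex
  assumes "inj f"
  shows "finite {i. Poly_Mapping.lookup \<beta> (f i) \<noteq> 0}"
proof -
  have "{i. Poly_Mapping.lookup \<beta> (f i) \<noteq> 0} = f -` Poly_Mapping.keys \<beta>"
    by (auto simp: in_keys_iff)
  then show ?thesis
    using finite_vimageI[OF finite_keys assms] by simp
qed

text \<open>Total degree, parabolic weight and both sums in the bracket have this form, with
  \<open>id\<close>, \<open>Zn\<close> or \<open>Zk\<close> for \<open>f\<close>; injectivity keeps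
  the supports finite.\<close>

lemma Sum_any_lookup_add:
  fixes g :: "'i \<Rightarrow> 'b::comm_semiring_1" and \<beta> \<gamma> :: mindex
  assumes "inj f"
  shows "Sum_any (\<lambda>i. g i * of_nat (Poly_Mapping.lookup (\<beta> + \<gamma>) (f i))) =
    Sum_any (\<lambda>i. g i * of_nat (Poly_Mapping.lookup \<beta> (f i))) +
    Sum_any (\<lambda>i. g i * of_nat (Poly_Mapping.lookup \<gamma> (f i)))"
proof -
  have fin: "finite {i. g i * of_nat (Poly_Mapping.lookup \<delta> (f i)) \<noteq> 0}" for \<delta> :: mindex
    by (rule finite_subset[OF _ finite_lookup_inj[OF assms, of \<delta>]])
      (rule Collect_mono, rule impI, erule contrapos_nn, simp)
  show ?thesis
    by (simp add: lookup_add distrib_left Sum_any.distrib[OF fin fin])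
qed

lemma Sum_any_lookup_unit:
  fixes g :: "'i \<Rightarrow> 'b::comm_semiring_1"
  assumes "inj f"
  shows "Sum_any (\<lambda>i. g i * of_nat (Poly_Mapping.lookup (unit_mi (f j)) (f i))) = g j"
proof -
  have "Sum_any (\<lambda>i. g i * of_nat (Poly_Mapping.lookup (unit_mi (f j)) (f i))) =
      (\<Sum>i\<in>{j}. g i * of_nat (Poly_Mapping.lookup (unit_mi (f j)) (f i)))"
    by (rule Sum_any.expand_superset) (auto simp: lookup_single when_def inj_eq[OF assms])
  then show ?thesis
    by simp
qed

lemma inj_var: "inj Zk" "inj Zn"
  by (auto simp: inj_def)

lemma msize_add: "msize (\<beta> + \<gamma>) = msize \<beta> + msize \<gamma>"
  using Sum_any_lookup_add[of id "\<lambda>_. 1 :: nat" \<beta> \<gamma>] by (simp add: msize_def)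

lemma msize_unit: "msize (unit_mi v) = 1"
  using Sum_any_lookup_unit[of id "\<lambda>_. 1 :: nat" v] by (simp add: msize_def)

lemma pweight_add: "pweight (\<beta> + \<gamma>) = pweight \<beta> + pweight \<gamma>"
  using Sum_any_lookup_add[OF inj_var(2), of "\<lambda>n. pnorm (pair_of n)" \<beta> \<gamma>] by (simp add: pweight_def)

lemma pweight_Zk: "pweight (unit_mi (Zk k)) = 0"
  by (simp add: pweight_def lookup_single)

lemma pweight_Zn: "pweight (unit_mi (Zn n)) = pnorm (pair_of n)"
  using Sum_any_lookup_unit[OF inj_var(2), of "\<lambda>n. pnorm (pair_of n)" n] by (simp add: pweight_def)

lemma bracket_add: "bracket (\<beta> + \<gamma>) = bracket \<beta> + bracket \<gamma>"
  using Sum_any_lookup_add[OF inj_var(1), of int \<beta> \<gamma>]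
    Sum_any_lookup_add[OF inj_var(2), of "\<lambda>_. 1 :: int" \<beta> \<gamma>]
  by (simp add: bracket_def)

lemma bracket_Zk: "bracket (unit_mi (Zk k)) = int k"
  using Sum_any_lookup_unit[OF inj_var(1), of int k] by (simp add: bracket_def lookup_single)

lemma bracket_Zn: "bracket (unit_mi (Zn n)) = - 1"
  using Sum_any_lookup_unit[OF inj_var(2), of "\<lambda>_. 1 :: int" n]
  by (simp add: bracket_def lookup_single)

lemma bracket_0: "bracket 0 = 0"
  by (simp add: bracket_def)

section \<open>Components of products and of the right-hand side\<close>

lemma coef_zvar_mult: "coef (zvar v * q) (unit_mi v + \<gamma>) = coef q \<gamma>"
proof -
  have "coef (zvar v * q) (unit_mi v + \<gamma>) =
      (\<Sum>(\<gamma>', \<gamma>'') \<in> {(unit_mi v, \<gamma>)}. coef (zvar v) \<gamma>' * coef q \<gamma>'')"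
    unfolding coef_mult
    by (rule sum.mono_neutral_right[OF finite_decomp]) (auto simp: zvar_def split: if_splits)
  then show ?thesis
    by (simp add: zvar_def)
qed

lemma coef_zvar_mult_eq_0:
  assumes "\<And>\<gamma>. \<beta> \<noteq> unit_mi v + \<gamma>"
  shows "coef (zvar v * q) \<beta> = 0"
  unfolding coef_mult
  by (rule sum.neutral) (use assms in \<open>auto simp: zvar_def split: if_splits\<close>)

lemma coef_ypoly:
  "coef (ypoly y) (unit_mi (Zn n)) = ymon y (pair_of n)"
  "(\<And>n. \<beta> \<noteq> unit_mi (Zn n)) \<Longrightarrow> coef (ypoly y) \<beta> = 0"
proof -
  have "coef (ypoly y) (unit_mi (Zn n)) =
      (\<Sum>m\<in>{n}. coef (ymon y (pair_of m) *\<^sub>R zvar (Zn m)) (unit_mi (Zn n)))"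
    unfolding ypoly_def zsum_def coef_zseries_of
    by (rule Sum_any.expand_superset)
      (auto simp: zvar_def dest!: arg_cong[of _ _ Poly_Mapping.keys] split: if_splits)
  then show "coef (ypoly y) (unit_mi (Zn n)) = ymon y (pair_of n)"
    by (simp add: zvar_def)
  show "coef (ypoly y) \<beta> = 0" if "\<And>n. \<beta> \<noteq> unit_mi (Zn n)"
    using that by (simp add: ypoly_def zsum_def zvar_def)
qed

lemma component_mult:
  "component (\<lambda>x y. V x y * W x y) \<beta> =
    (\<lambda>x y. \<Sum>(\<gamma>, \<gamma>') \<in> {(\<gamma>, \<gamma>'). \<gamma> + \<gamma>' = \<beta>}. component V \<gamma> x y * component W \<gamma>' x y)"
  by (simp add: component_def coef_mult)

text \<open>Only those k with e_k \<le> \<beta> contribute, so the componentwise sum becomes a sum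
  over a finite set that does not depend on \<Phi>.\<close>

lemma coef_Pi_minus:
  "coef (Pi_minus \<xi> \<Phi> x y) \<beta> =
    (\<Sum>k\<in>Zk -` Poly_Mapping.keys \<beta>. coef (zvar (Zk k) * (\<Phi> x y ^ k * D1 (D1 \<Phi>) x y)) \<beta>)
      + (if \<beta> = 0 then \<xi> x else 0)"
proof -
  let ?F = "\<lambda>k. zvar (Zk k) * (\<Phi> x y ^ k * D1 (D1 \<Phi>) x y)"
  have "{k. coef (?F k) \<beta> \<noteq> 0} \<subseteq> Zk -` Poly_Mapping.keys \<beta>"
  proof
    fix k assume "k \<in> {k. coef (?F k) \<beta> \<noteq> 0}"
    then obtain \<gamma> where "\<beta> = unit_mi (Zk k) + \<gamma>"
      using coef_zvar_mult_eq_0 by blast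
    then show "k \<in> Zk -` Poly_Mapping.keys \<beta>"
      by (simp add: in_keys_iff lookup_add)
  qed
  then have "Sum_any (\<lambda>k. coef (?F k) \<beta>) = (\<Sum>k\<in>Zk -` Poly_Mapping.keys \<beta>. coef (?F k) \<beta>)"
    by (intro Sum_any.expand_superset finite_vimageI inj_var finite_keys)
  then show ?thesis
    by (simp add: Pi_minus_def zsum_def mult.assoc coef_one)
qed

lemma component_Pi_minus:
  "component (Pi_minus \<xi> \<Phi>) \<beta> = (\<lambda>x y.
    (\<Sum>k\<in>Zk -` Poly_Mapping.keys \<beta>.
      component (\<lambda>x y. zvar (Zk k) * (\<Phi> x y ^ k * D1 (D1 \<Phi>) x y)) \<beta> x y)
      + (if \<beta> = 0 then \<xi> x else 0))"
  by (simp add: component_def coef_Pi_minus)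

lemma component_zvar_mult:
  "component (\<lambda>x y. zvar v * W x y) (unit_mi v + \<gamma>) = component W \<gamma>"
  by (simp add: component_def coef_zvar_mult)

lemma component_zvar_mult_eq_0:
  "(\<And>\<gamma>. \<beta> \<noteq> unit_mi v + \<gamma>) \<Longrightarrow> component (\<lambda>x y. zvar v * W x y) \<beta> = (\<lambda>x y. 0)"
  by (simp add: component_def coef_zvar_mult_eq_0)

text \<open>Congruence modulo the ideal of series without terms of total degree below
  \<open>n\<close>: it respects products, and multiplication by a variable gains one degree. That
  gain is what makes the recursion well-founded.\<close>

definition agree_below :: "nat \<Rightarrow> zseries \<Rightarrow> zseries \<Rightarrow> bool" where
  "agree_below n p q \<longleftrightarrow> (\<forall>\<beta>. msize \<beta> < n \<longrightarrow> coef p \<beta> = coef q \<beta>)"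

lemma agree_below_mult:
  "agree_below n p p' \<Longrightarrow> agree_below n q q' \<Longrightarrow> agree_below n (p * q) (p' * q')"
  unfolding agree_below_def coef_mult
  by (intro allI impI sum.cong) (auto simp: msize_add)

lemma agree_below_power: "agree_below n p q \<Longrightarrow> agree_below n (p ^ k) (q ^ k)"
  by (induction k) (auto intro: agree_below_mult simp: agree_below_def[of _ 1])

lemma agree_below_zvar_mult:
  assumes "agree_below n p q"
  shows "agree_below (Suc n) (zvar v * p) (zvar v * q)"
  unfolding agree_below_def
proof (intro allI impI)
  fix \<beta> assume \<beta>: "msize \<beta> < Suc n"
  show "coef (zvar v * p) \<beta> = coef (zvar v * q) \<beta>"
  proof (cases "\<exists>\<gamma>. \<beta> = unit_mi v + \<gamma>")
    case True
    then obtain \<gamma> where "\<beta> = unit_mi v + \<gamma>" ..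
    with assms \<beta> show ?thesis
      by (simp add: coef_zvar_mult agree_below_def msize_add msize_unit)
  qed (simp add: coef_zvar_mult_eq_0)
qed

lemma component_Pi_minus_cong:
  assumes "\<And>\<gamma>. msize \<gamma> < msize \<beta> \<Longrightarrow> component \<Phi> \<gamma> = component \<Psi> \<gamma>"
  shows "component (Pi_minus \<xi> \<Phi>) \<beta> = component (Pi_minus \<xi> \<Psi>) \<beta>"
proof -
  have 0: "agree_below (msize \<beta>) (\<Phi> x y) (\<Psi> x y)" for x y
    unfolding agree_below_def using assms by (auto simp: component_def dest!: fun_cong)
  have "component (D1 (D1 \<Phi>)) \<gamma> = component (D1 (D1 \<Psi>)) \<gamma>" if "msize \<gamma> < msize \<beta>" for \<gamma>
    by (simp add: component_DD assms that)
  then have 1: "agree_below (msize \<beta>) (D1 (D1 \<Phi>) x y) (D1 (D1 \<Psi>) x y)" for x y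
    unfolding agree_below_def by (auto simp: component_def dest!: fun_cong)
  have "agree_below (Suc (msize \<beta>)) (zvar (Zk k) * (\<Phi> x y ^ k * D1 (D1 \<Phi>) x y))
      (zvar (Zk k) * (\<Psi> x y ^ k * D1 (D1 \<Psi>) x y))" for k x y
    by (intro agree_below_zvar_mult agree_below_mult agree_below_power 0 1)
  then show ?thesis
    unfolding component_Pi_minus unfolding component_def agree_below_def by simp
qed

text \<open>The degree bound of the theorem, truncated at total degree \<open>n\<close> so that it
  can serve as induction hypothesis. Products preserve it because degree bounds and weights both
  add, and z_k preserves it because e_k has weight 0.\<close>

definition weight_graded :: "nat \<Rightarrow> (real \<times> real \<Rightarrow> real \<times> real \<Rightarrow> zseries) \<Rightarrow> bool" where
  "weight_graded n W \<longleftrightarrow>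
     (\<forall>\<beta>. msize \<beta> < n \<longrightarrow> ppoly (below (Suc (pweight \<beta>))) (component W \<beta>))"

lemma weight_graded_mult:
  assumes "weight_graded n V" "weight_graded n W"
  shows "weight_graded n (\<lambda>x y. V x y * W x y)"
  unfolding weight_graded_def
proof (intro allI impI)
  fix \<beta> assume \<beta>: "msize \<beta> < n"
  show "ppoly (below (Suc (pweight \<beta>))) (component (\<lambda>x y. V x y * W x y) \<beta>)"
    unfolding component_mult case_prod_unfold
  proof (rule ppoly_sum)
    fix p assume "p \<in> {p. fst p + snd p = \<beta>}"
    then have "\<beta> = fst p + snd p"
      by simp
    with assms \<beta>
    show "ppoly (below (Suc (pweight \<beta>))) (\<lambda>x y. component V (fst p) x y * component W (snd p) x y)"
      by (auto simp: weight_graded_def msize_add pweight_add intro!: ppoly_mult)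
  qed
qed

lemma ppoly_x_function:
  assumes "smooth c" "cell_periodic c"
  shows "ppoly (below (Suc N)) (\<lambda>x y. c x)"
  using ppoly_monomial[of "below (Suc N)" "(0, 0)" c] assms by (simp add: pnorm_def ymon_def)

lemma weight_graded_one: "weight_graded n (\<lambda>x y. 1)"
  unfolding weight_graded_def component_def coef_one
  by (intro allI impI ppoly_x_function smooth_const cell_periodic_const)

lemma weight_graded_power: "weight_graded n W \<Longrightarrow> weight_graded n (\<lambda>x y. W x y ^ k)"
  by (induction k) (simp_all add: weight_graded_one weight_graded_mult)

lemma weight_graded_zvar_mult:
  assumes "weight_graded n W"
  shows "weight_graded (Suc n) (\<lambda>x y. zvar (Zk k) * W x y)"
  unfolding weight_graded_def
proof (intro allI impI)
  fix \<beta> assume \<beta>: "msize \<beta> < Suc n"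
  show "ppoly (below (Suc (pweight \<beta>))) (component (\<lambda>x y. zvar (Zk k) * W x y) \<beta>)"
  proof (cases "\<exists>\<gamma>. \<beta> = unit_mi (Zk k) + \<gamma>")
    case True
    then obtain \<gamma> where "\<beta> = unit_mi (Zk k) + \<gamma>" ..
    with assms \<beta> show ?thesis
      by (simp add: component_zvar_mult weight_graded_def msize_add msize_unit pweight_add pweight_Zk)
  qed (simp add: component_zvar_mult_eq_0 ppoly_zero)
qed

lemma weight_graded_DD: "weight_graded n W \<Longrightarrow> weight_graded n (DD v W)"
  by (simp add: weight_graded_def component_DD ppoly_dd)

lemma ppoly_component_Pi_minus:
  assumes \<xi>: "smooth \<xi>" "cell_periodic \<xi>"
    and "\<And>\<gamma>. msize \<gamma> < msize \<beta> \<Longrightarrow> ppoly (below (Suc (pweight \<gamma>))) (component \<Phi> \<gamma>)"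
  shows "ppoly (below (Suc (pweight \<beta>))) (component (Pi_minus \<xi> \<Phi>) \<beta>)"
proof -
  have \<Phi>: "weight_graded (msize \<beta>) \<Phi>"
    using assms(3) by (simp add: weight_graded_def)
  have "weight_graded (Suc (msize \<beta>)) (\<lambda>x y. zvar (Zk k) * (\<Phi> x y ^ k * D1 (D1 \<Phi>) x y))" for k
    by (intro weight_graded_zvar_mult weight_graded_mult weight_graded_power weight_graded_DD \<Phi>)
  moreover have "ppoly (below (Suc (pweight \<beta>))) (\<lambda>x y. if \<beta> = 0 then \<xi> x else 0)"
    by (cases "\<beta> = 0") (auto intro: ppoly_x_function \<xi> ppoly_zero)
  ultimately show ?thesis
    unfolding component_Pi_minus by (intro ppoly_add ppoly_sum) (auto simp: weight_graded_def)
qed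

text \<open>At the threshold \<open>[\<beta>] = - j\<close> components need not vanish, but they are constant in \<open>x\<close>. The
  threshold \<open>1\<close> of the unknown is reproduced by the nonlinearity because \<open>\<Pi>\<^sup>k D\<^sub>1\<^sup>2 \<Pi>\<close> has
  threshold \<open>k + 1\<close> while \<open>[e\<^sub>k] = k\<close>.\<close>

definition bracket_bounded ::
    "int \<Rightarrow> nat \<Rightarrow> (real \<times> real \<Rightarrow> real \<times> real \<Rightarrow> zseries) \<Rightarrow> bool" where
  "bracket_bounded j n W \<longleftrightarrow> (\<forall>\<beta>. msize \<beta> < n \<longrightarrow>
     (bracket \<beta> < - j \<longrightarrow> component W \<beta> = (\<lambda>x y. 0)) \<and>
     (bracket \<beta> = - j \<longrightarrow> (\<exists>p. component W \<beta> = (\<lambda>x y. p y))))"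

lemma bracket_boundedD:
  assumes "bracket_bounded j n W" "msize \<beta> < n"
  shows "bracket \<beta> < - j \<Longrightarrow> component W \<beta> = (\<lambda>x y. 0)"
    and "bracket \<beta> \<le> - j \<Longrightarrow> component W \<beta> x y = component W \<beta> x' y"
proof -
  show *: "component W \<beta> = (\<lambda>x y. 0)" if "bracket \<beta> < - j"
    using assms that unfolding bracket_bounded_def by blast
  show "component W \<beta> x y = component W \<beta> x' y" if "bracket \<beta> \<le> - j"
  proof (cases "bracket \<beta> = - j")
    case True
    then have "\<exists>p. component W \<beta> = (\<lambda>x y. p y)"
      using assms by (simp add: bracket_bounded_def)
    then obtain p where "component W \<beta> = (\<lambda>x y. p y)" ..
    then show ?thesis
      by simp
  next
    case False
    then show ?thesis
      using * that by simp
  qed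
qed

lemma bracket_boundedI:
  assumes "\<And>\<beta>. msize \<beta> < n \<Longrightarrow> bracket \<beta> < - j \<Longrightarrow> component W \<beta> = (\<lambda>x y. 0)"
    and "\<And>\<beta> x x' y. msize \<beta> < n \<Longrightarrow> bracket \<beta> = - j \<Longrightarrow> component W \<beta> x y = component W \<beta> x' y"
  shows "bracket_bounded j n W"
  unfolding bracket_bounded_def
proof (intro allI impI conjI)
  fix \<beta> assume "msize \<beta> < n" "bracket \<beta> = - j"
  then show "\<exists>p. component W \<beta> = (\<lambda>x y. p y)"
    using assms(2) by (intro exI[of _ "component W \<beta> 0"] ext)
qed (use assms in auto)

text \<open>Brackets add. If \<gamma> + \<gamma>' sits at the threshold -(i + j), then either one
  summand is below its own threshold and the product vanishes, or both are exactly at theirs and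
  both factors are constant in x.\<close>

lemma bracket_bounded_mult:
  assumes V: "bracket_bounded i n V" and W: "bracket_bounded j n W"
  shows "bracket_bounded (i + j) n (\<lambda>x y. V x y * W x y)"
proof (rule bracket_boundedI)
  have sub: "msize \<gamma> < n" "msize \<gamma>' < n" if "msize \<beta> < n" "\<gamma> + \<gamma>' = \<beta>" for \<beta> \<gamma> \<gamma>'
    using that msize_add[of \<gamma> \<gamma>'] by auto
  have zero: "component V \<gamma> x y * component W \<gamma>' x y = 0"
    if "msize \<beta> < n" "\<gamma> + \<gamma>' = \<beta>" "bracket \<gamma> < - i \<or> bracket \<gamma>' < - j" for \<beta> \<gamma> \<gamma>' x y
    using that(3) bracket_boundedD(1)[OF V sub(1)[OF that(1,2)]]
      bracket_boundedD(1)[OF W sub(2)[OF that(1,2)]] by auto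
  fix \<beta> assume \<beta>: "msize \<beta> < n"
  show "component (\<lambda>x y. V x y * W x y) \<beta> = (\<lambda>x y. 0)" if less: "bracket \<beta> < - (i + j)"
    unfolding component_mult
  proof (intro ext sum.neutral ballI)
    fix x y p assume "p \<in> {(\<gamma>, \<gamma>'). \<gamma> + \<gamma>' = \<beta>}"
    then obtain \<gamma> \<gamma>' where p: "p = (\<gamma>, \<gamma>')" "\<gamma> + \<gamma>' = \<beta>"
      by auto
    then have "bracket \<gamma> < - i \<or> bracket \<gamma>' < - j"
      using less bracket_add[of \<gamma> \<gamma>'] by auto
    with zero[OF \<beta> p(2)] show "(case p of (\<gamma>, \<gamma>') \<Rightarrow> component V \<gamma> x y * component W \<gamma>' x y) = 0"
      by (simp add: p)
  qed
  show "component (\<lambda>x y. V x y * W x y) \<beta> x y = component (\<lambda>x y. V x y * W x y) \<beta> x' y"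
    if eq: "bracket \<beta> = - (i + j)" for x x' y
    unfolding component_mult
  proof (intro sum.cong refl)
    fix p assume "p \<in> {(\<gamma>, \<gamma>'). \<gamma> + \<gamma>' = \<beta>}"
    then obtain \<gamma> \<gamma>' where p: "p = (\<gamma>, \<gamma>')" "\<gamma> + \<gamma>' = \<beta>"
      by auto
    show "(case p of (\<gamma>, \<gamma>') \<Rightarrow> component V \<gamma> x y * component W \<gamma>' x y) =
        (case p of (\<gamma>, \<gamma>') \<Rightarrow> component V \<gamma> x' y * component W \<gamma>' x' y)"
    proof (cases "bracket \<gamma> < - i \<or> bracket \<gamma>' < - j")
      case True
      show ?thesis
        by (simp only: p split zero[OF \<beta> p(2) True])
    next
      case False
      then have "bracket \<gamma> \<le> - i" "bracket \<gamma>' \<le> - j"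
        using eq p(2) bracket_add[of \<gamma> \<gamma>'] by auto
      then show ?thesis
        using bracket_boundedD(2)[OF V sub(1)[OF \<beta> p(2)], of x y x']
          bracket_boundedD(2)[OF W sub(2)[OF \<beta> p(2)], of x y x'] by (simp add: p)
    qed
  qed
qed

lemma bracket_bounded_one: "bracket_bounded 0 n (\<lambda>x y. 1)"
  by (rule bracket_boundedI) (auto simp: component_def coef_one bracket_0 fun_eq_iff)

lemma bracket_bounded_power:
  "bracket_bounded 1 n W \<Longrightarrow> bracket_bounded (int k) n (\<lambda>x y. W x y ^ k)"
proof (induction k)
  case 0
  then show ?case
    using bracket_bounded_one by simp
next
  case (Suc k)
  then show ?case
    using bracket_bounded_mult[of 1 n W "int k"] by simp
qed

lemma bracket_bounded_zvar_mult:
  assumes "bracket_bounded (j + int k) n W"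
  shows "bracket_bounded j (Suc n) (\<lambda>x y. zvar (Zk k) * W x y)"
proof (rule bracket_boundedI)
  fix \<beta> assume \<beta>: "msize \<beta> < Suc n"
  show "component (\<lambda>x y. zvar (Zk k) * W x y) \<beta> = (\<lambda>x y. 0)" if "bracket \<beta> < - j"
  proof (cases "\<exists>\<gamma>. \<beta> = unit_mi (Zk k) + \<gamma>")
    case True
    then obtain \<gamma> where \<gamma>: "\<beta> = unit_mi (Zk k) + \<gamma>" ..
    then show ?thesis
      using bracket_boundedD(1)[OF assms, of \<gamma>] \<beta> that
      by (simp add: component_zvar_mult msize_add msize_unit bracket_add bracket_Zk)
  qed (simp add: component_zvar_mult_eq_0)
  show "component (\<lambda>x y. zvar (Zk k) * W x y) \<beta> x y = component (\<lambda>x y. zvar (Zk k) * W x y) \<beta> x' y"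
    if "bracket \<beta> = - j" for x x' y
  proof (cases "\<exists>\<gamma>. \<beta> = unit_mi (Zk k) + \<gamma>")
    case True
    then obtain \<gamma> where \<gamma>: "\<beta> = unit_mi (Zk k) + \<gamma>" ..
    then show ?thesis
      using bracket_boundedD(2)[OF assms, of \<gamma> x y x'] \<beta> that
      by (simp add: component_zvar_mult msize_add msize_unit bracket_add bracket_Zk)
  qed (simp add: component_zvar_mult_eq_0)
qed

lemma bracket_bounded_DD:
  assumes "bracket_bounded j n W"
  shows "bracket_bounded j n (DD v W)"
proof (rule bracket_boundedI)
  fix \<beta> assume \<beta>: "msize \<beta> < n"
  show "component (DD v W) \<beta> = (\<lambda>x y. 0)" if "bracket \<beta> < - j"
    using bracket_boundedD(1)[OF assms \<beta> that] by (simp add: component_DD dd_zero)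
  show "component (DD v W) \<beta> x y = component (DD v W) \<beta> x' y" if "bracket \<beta> = - j" for x x' y
  proof -
    have "\<exists>p. component W \<beta> = (\<lambda>x y. p y)"
      using assms \<beta> that by (simp add: bracket_bounded_def)
    then obtain p where "component W \<beta> = (\<lambda>x y. p y)" ..
    then show ?thesis
      by (simp add: component_DD dd_def)
  qed
qed

text \<open>The bracket is an integer, so a negative one is at most -1, the threshold at which
  components are constant in x. The noise sits at the index 0, whose bracket is 0, and does not
  enter.\<close>

lemma component_Pi_minus_bracket:
  assumes "bracket_bounded 1 (msize \<beta>) \<Phi>" "bracket \<beta> < 0"
  shows "component (Pi_minus \<xi> \<Phi>) \<beta> x y = component (Pi_minus \<xi> \<Phi>) \<beta> x' y"
proof -
  have "bracket_bounded 1 (Suc (msize \<beta>)) (\<lambda>x y. zvar (Zk k) * (\<Phi> x y ^ k * D1 (D1 \<Phi>) x y))" for k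
    by (rule bracket_bounded_zvar_mult, subst add.commute)
      (intro bracket_bounded_mult bracket_bounded_power bracket_bounded_DD assms)
  from bracket_boundedD(2)[OF this, of \<beta> _ x y x'] assms(2) show ?thesis
    unfolding component_Pi_minus by (auto simp: bracket_0)
qed

section \<open>Recursive construction of the components\<close>

lemma lifted_heat_ymon:
  obtains Q where "real_polynomial_function Q" "lifted_heat (\<lambda>x y. ymon y n) = (\<lambda>x y. Q y)"
proof -
  have dymon: "dd v (\<lambda>x y. r * ymon y m) = (\<lambda>x y. r * dymon v m y)" for v r m
    using dd_monomial[OF smooth_const, of v r m] by (simp add: dderiv_const)
  have "dd (1, 0) (dd (1, 0) (\<lambda>x y. ymon y n)) =
      (\<lambda>x y. real (fst n) * dymon (1, 0) (fst n - 1, snd n) y)"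
    using dymon[of _ 1 n] dymon[of "(1, 0)" "real (fst n)" "(fst n - 1, snd n)"] by (simp add: dymon_def)
  then have "lifted_heat (\<lambda>x y. ymon y n) =
      (\<lambda>x y. dymon (0, 1) n y - real (fst n) * dymon (1, 0) (fst n - 1, snd n) y)"
    using dymon[of "(0, 1)" 1 n] by (simp add: lifted_heat_def fun_eq_iff)
  moreover have "real_polynomial_function (dymon v m)" for v m
    unfolding dymon_def[abs_def]
    by (intro real_polynomial_function.intros(2,3,4) real_polynomial_function_ymon)
  then have "real_polynomial_function
      (\<lambda>y. dymon (0, 1) n y - real (fst n) * dymon (1, 0) (fst n - 1, snd n) y)"
    by (intro real_polynomial_function_diff real_polynomial_function.intros(2,4))
  ultimately show ?thesis
    by (rule that[rotated])
qed

text \<open>A predicate on pairs, so that one choice fixes the solution and its polynomial together.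
  The degree bound is included because the existence of the next components depends on it.\<close>

definition solves_component :: "mindex \<Rightarrow> (real \<times> real \<Rightarrow> real \<times> real \<Rightarrow> real) \<Rightarrow>
    (real \<times> real \<Rightarrow> real \<times> real \<Rightarrow> real) \<times> (real \<times> real \<Rightarrow> real) \<Rightarrow> bool" where
  "solves_component \<beta> F = (\<lambda>(U, p). ppoly (below (Suc (pweight \<beta>))) U \<and> real_polynomial_function p \<and>
     (\<forall>x y. lifted_heat U x y + p y = F x y) \<and> (\<forall>y. xmean U y = coef (ypoly y) \<beta>))"

lemma ppoly_ymon: "pnorm n < N \<Longrightarrow> ppoly (below N) (\<lambda>x y. ymon y n)"
  using ppoly_monomial[of "below N" n "\<lambda>_. 1"] by (simp add: smooth_const cell_periodic_const)

lemma solves_component_exists: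
  assumes "ppoly (below (Suc (pweight \<beta>))) F"
  shows "\<exists>S. solves_component \<beta> F S"
proof -
  from lifted_heat_solution[OF assms] obtain U p where U: "ppoly (below (Suc (pweight \<beta>))) U"
      "\<And>y. xmean U y = 0" and p: "real_polynomial_function p" "\<And>x y. lifted_heat U x y + p y = F x y"
    by blast
  show ?thesis
  proof (cases "\<exists>n. \<beta> = unit_mi (Zn n)")
    case True
    then obtain n where \<beta>: "\<beta> = unit_mi (Zn n)" ..
    obtain Q where Q: "real_polynomial_function Q" "lifted_heat (\<lambda>x y. ymon y (pair_of n)) = (\<lambda>x y. Q y)"
      by (rule lifted_heat_ymon)
    have Y: "ppoly (below (Suc (pweight \<beta>))) (\<lambda>x y. ymon y (pair_of n))"
      by (rule ppoly_ymon) (simp add: \<beta> pweight_Zn)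
    \<comment> \<open>Adding y^n to the mean-free solution produces the required average; its image
      \<open>Q\<close> depends on y alone and is compensated in the polynomial.\<close>
    have "solves_component \<beta> F (\<lambda>x y. U x y + ymon y (pair_of n), \<lambda>y. p y - Q y)"
      unfolding solves_component_def split
    proof (intro conjI allI)
      show "ppoly (below (Suc (pweight \<beta>))) (\<lambda>x y. U x y + ymon y (pair_of n))"
        by (rule ppoly_add[OF U(1) Y])
      show "real_polynomial_function (\<lambda>y. p y - Q y)"
        by (rule real_polynomial_function_diff[OF p(1) Q(1)])
      show "lifted_heat (\<lambda>x y. U x y + ymon y (pair_of n)) x y + (p y - Q y) = F x y" for x y
        using p(2)[of x y] by (simp add: lifted_heat_add[OF U(1) Y] Q(2))
      show "xmean (\<lambda>x y. U x y + ymon y (pair_of n)) y = coef (ypoly y) \<beta>" for y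
        unfolding xmean_add[OF U(1) Y] U(2) by (simp add: \<beta> coef_ypoly xmean_def)
    qed
    then show ?thesis ..
  next
    case False
    then have "solves_component \<beta> F (U, p)"
      using U p by (simp add: solves_component_def coef_ypoly)
    then show ?thesis ..
  qed
qed

text \<open>The guard on \<open>msize\<close> makes the recursive calls visibly decrease, and the
  default 0 is immaterial by \<open>component_Pi_minus_cong\<close>. That the choice succeeds is
  only established in \<open>solves_exists\<close>, by an induction that supplies the degree bounds
  at smaller indices.\<close>

function Pi_component :: "(real \<times> real \<Rightarrow> real) \<Rightarrow> mindex \<Rightarrow> real \<times> real \<Rightarrow> real \<times> real \<Rightarrow> real" where
  "Pi_component \<xi> \<beta> = fst (SOME S. solves_component \<beta> (component (Pi_minus \<xi> (\<lambda>x y. zseries_of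
     (\<lambda>\<gamma>. if msize \<gamma> < msize \<beta> then Pi_component \<xi> \<gamma> x y else 0))) \<beta>) S)"
  by auto
termination
  by (relation "Wellfounded.measure (\<lambda>(\<xi>, \<beta>). msize \<beta>)") auto

declare Pi_component.simps [simp del]

section \<open>From the components back to the system\<close>

lemma periodic_polynomial_cell_mean:
  assumes "periodic_polynomial U"
  shows "(LINT x:unit_cell|lborel. U x y) = xmean U y"
proof -
  from assms obtain N where "ppoly (below N) U"
    unfolding periodic_polynomial_iff ..
  from set_lebesgue_unit_cell[OF ppoly_continuous_on[OF this]] show ?thesis
    by (simp add: xmean_def)
qed

lemma coef_cell_mean:
  assumes "periodic_polynomial (component W \<beta>)"
  shows "coef (cell_mean (\<lambda>x. W x y)) \<beta> = xmean (component W \<beta>) y"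
  using periodic_polynomial_cell_mean[OF assms] by (simp add: cell_mean_def component_def)

lemma solves_iff:
  "solves \<xi> \<Phi> P \<longleftrightarrow> (\<forall>\<beta>. periodic_polynomial (component \<Phi> \<beta>) \<and>
     real_polynomial_function (\<lambda>y. coef (P y) \<beta>) \<and>
     (\<forall>x y. lifted_heat (component \<Phi> \<beta>) x y + coef (P y) \<beta> = component (Pi_minus \<xi> \<Phi>) \<beta> x y) \<and>
     (\<forall>y. xmean (component \<Phi> \<beta>) y = coef (ypoly y) \<beta>))"
proof -
  have "D2 \<Phi> x y - D1 (D1 \<Phi>) x y + P y = Pi_minus \<xi> \<Phi> x y \<longleftrightarrow>
      (\<forall>\<beta>. lifted_heat (component \<Phi> \<beta>) x y + coef (P y) \<beta> = component (Pi_minus \<xi> \<Phi>) \<beta> x y)" for x y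
  proof -
    have "coef (D2 \<Phi> x y - D1 (D1 \<Phi>) x y + P y) \<beta> = lifted_heat (component \<Phi> \<beta>) x y + coef (P y) \<beta>" for \<beta>
      unfolding lifted_heat_def component_DD[symmetric] by (simp add: component_def)
    then show ?thesis
      by (metis component_def zseries_eqI)
  qed
  moreover have "cell_mean (\<lambda>x. \<Phi> x y) = ypoly y \<longleftrightarrow>
      (\<forall>\<beta>. xmean (component \<Phi> \<beta>) y = coef (ypoly y) \<beta>)"
    if "\<forall>\<beta>. periodic_polynomial (component \<Phi> \<beta>)" for y
    using that coef_cell_mean by (metis zseries_eqI)
  ultimately show ?thesis
    unfolding solves_def by blast
qed

lemma solvesD:
  assumes "solves \<xi> \<Phi> P"
  shows "periodic_polynomial (component \<Phi> \<beta>)"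
    and "lifted_heat (component \<Phi> \<beta>) x y + coef (P y) \<beta> = component (Pi_minus \<xi> \<Phi>) \<beta> x y"
    and "xmean (component \<Phi> \<beta>) y = coef (ypoly y) \<beta>"
  using assms unfolding solves_iff by blast+

lemma solves_exists:
  assumes \<xi>: "smooth \<xi>" "cell_periodic \<xi>"
  obtains \<Phi> P where "solves \<xi> \<Phi> P"
    "\<And>\<beta>. ppoly (below (Suc (pweight \<beta>))) (component \<Phi> \<beta>)"
proof -
  define \<Phi> where "\<Phi> x y = zseries_of (\<lambda>\<beta>. Pi_component \<xi> \<beta> x y)" for x y
  \<comment> \<open>This is the choice made inside \<open>Pi_component\<close>, with the guard
    removed; its second entry therefore is the polynomial belonging to the component already
    constructed.\<close>
  define S where "S \<beta> = (SOME S. solves_component \<beta> (component (Pi_minus \<xi> \<Phi>) \<beta>) S)" for \<beta>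
  define P where "P y = zseries_of (\<lambda>\<beta>. snd (S \<beta>) y)" for y
  have \<Phi>: "component \<Phi> \<beta> = Pi_component \<xi> \<beta>" for \<beta>
    by (simp add: component_def \<Phi>_def)
  have \<Phi>_S: "component \<Phi> \<beta> = fst (S \<beta>)" for \<beta>
  proof -
    have "component (Pi_minus \<xi> (\<lambda>x y. zseries_of
        (\<lambda>\<gamma>. if msize \<gamma> < msize \<beta> then Pi_component \<xi> \<gamma> x y else 0))) \<beta> = component (Pi_minus \<xi> \<Phi>) \<beta>"
      by (rule component_Pi_minus_cong) (simp add: \<Phi>_def component_def)
    then show ?thesis
      unfolding \<Phi> S_def by (subst Pi_component.simps) simp
  qed
  have S: "solves_component \<beta> (component (Pi_minus \<xi> \<Phi>) \<beta>) (S \<beta>)" for \<beta>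
  proof (induction "msize \<beta>" arbitrary: \<beta> rule: less_induct)
    case less
    have "ppoly (below (Suc (pweight \<gamma>))) (component \<Phi> \<gamma>)" if "msize \<gamma> < msize \<beta>" for \<gamma>
      using less[OF that] by (simp add: solves_component_def \<Phi>_S case_prod_unfold)
    then show ?case
      unfolding S_def
      by (rule someI_ex[OF solves_component_exists[OF ppoly_component_Pi_minus[OF \<xi>]]])
  qed
  show ?thesis
  proof
    show ppoly: "ppoly (below (Suc (pweight \<beta>))) (component \<Phi> \<beta>)" for \<beta>
      using S[of \<beta>] by (simp add: solves_component_def \<Phi>_S case_prod_unfold)
    then have "periodic_polynomial (component \<Phi> \<beta>)" for \<beta>
      unfolding periodic_polynomial_iff by blast
    then show "solves \<xi> \<Phi> P"
      unfolding solves_iff using S by (simp add: solves_component_def \<Phi>_S case_prod_unfold P_def)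
  qed
qed

lemma solves_unique:
  assumes "solves \<xi> \<Phi> P" "solves \<xi> \<Psi> Q"
  shows "\<Phi> = \<Psi> \<and> P = Q"
proof -
  have eq: "component \<Phi> \<beta> = component \<Psi> \<beta> \<and> (\<lambda>y. coef (P y) \<beta>) = (\<lambda>y. coef (Q y) \<beta>)" for \<beta>
  proof (induction "msize \<beta>" arbitrary: \<beta> rule: less_induct)
    case less
    have F: "component (Pi_minus \<xi> \<Phi>) \<beta> = component (Pi_minus \<xi> \<Psi>) \<beta>"
      using less by (intro component_Pi_minus_cong) blast
    show ?case
      by (rule lifted_heat_unique)
        (simp_all only: solvesD[OF assms(1)] solvesD[OF assms(2)] F)
  qed
  have "\<Phi> x y = \<Psi> x y" for x y
    using eq by (intro zseries_eqI) (auto simp: component_def dest!: fun_cong)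
  moreover have "P y = Q y" for y
    using eq by (intro zseries_eqI) (auto dest!: fun_cong)
  ultimately show ?thesis
    by blast
qed

lemma periodic_polynomial_ymon: "periodic_polynomial (\<lambda>x y. ymon y n)"
  unfolding periodic_polynomial_iff using ppoly_ymon lessI by blast

text \<open>No variable z_k divides z_n, so the right-hand side vanishes at e_n. The monomial y^n
  has the required average and its image under the operator depends on y alone, so it is the
  solution.\<close>

lemma component_unit:
  assumes "solves \<xi> \<Phi> P"
  shows "component \<Phi> (unit_mi (Zn n)) = (\<lambda>x y. ymon y (pair_of n))"
proof -
  let ?\<beta> = "unit_mi (Zn n)"
  obtain Q where Q: "lifted_heat (\<lambda>x y. ymon y (pair_of n)) = (\<lambda>x y. Q y)"
    by (rule lifted_heat_ymon)
  have "Zk -` Poly_Mapping.keys ?\<beta> = {}"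
    by auto
  moreover have "?\<beta> \<noteq> 0"
    using msize_unit[of "Zn n"] by (auto simp: msize_def)
  ultimately have "component (Pi_minus \<xi> \<Phi>) ?\<beta> = (\<lambda>x y. 0)"
    by (simp add: component_Pi_minus)
  note F = this
  have "lifted_heat (component \<Phi> ?\<beta>) x y + coef (P y) ?\<beta> =
      lifted_heat (\<lambda>x y. ymon y (pair_of n)) x y + - Q y" for x y
    by (simp only: solvesD(2)[OF assms] F Q right_minus)
  note eq = this
  have mean: "xmean (component \<Phi> ?\<beta>) y = xmean (\<lambda>x y. ymon y (pair_of n)) y" for y
    by (simp only: solvesD(3)[OF assms] coef_ypoly) (simp add: xmean_def)
  from lifted_heat_unique[OF solvesD(1)[OF assms] periodic_polynomial_ymon mean eq] show ?thesis ..
qed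

lemma component_negative_bracket:
  assumes "solves \<xi> \<Phi> P" "bracket \<beta> < 0" "\<And>n. \<beta> \<noteq> unit_mi (Zn n)"
  shows "component \<Phi> \<beta> = (\<lambda>x y. 0)"
  using assms(2,3)
proof (induction "msize \<beta>" arbitrary: \<beta> rule: less_induct)
  case less
  \<comment> \<open>Unit indices e_n have bracket exactly -1. Below -1 the induction hypothesis thus
    gives zero, and at -1 a component is either zero or a monomial in y.\<close>
  have "bracket_bounded 1 (msize \<beta>) \<Phi>"
  proof (rule bracket_boundedI)
    fix \<gamma> assume \<gamma>: "msize \<gamma> < msize \<beta>"
    show "component \<Phi> \<gamma> = (\<lambda>x y. 0)" if "bracket \<gamma> < - 1"
      using less.hyps[OF \<gamma>] that bracket_Zn by force
    show "component \<Phi> \<gamma> x y = component \<Phi> \<gamma> x' y" if "bracket \<gamma> = - 1" for x x' y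
      using less.hyps[OF \<gamma>] that component_unit[OF assms(1)]
      by (cases "\<exists>n. \<gamma> = unit_mi (Zn n)") auto
  qed
  from component_Pi_minus_bracket[OF this less.prems(1)]
  have F: "component (Pi_minus \<xi> \<Phi>) \<beta> x y = component (Pi_minus \<xi> \<Phi>) \<beta> 0 y" for x y .
  \<comment> \<open>The zero function solves the same linear problem, with the right-hand side,
    evaluated at x = 0, as its polynomial part.\<close>
  have "lifted_heat (component \<Phi> \<beta>) x y + coef (P y) \<beta> =
      lifted_heat (\<lambda>x y. 0) x y + component (Pi_minus \<xi> \<Phi>) \<beta> 0 y" for x y
    using F[of x y] by (simp only: solvesD(2)[OF assms(1)] lifted_heat_zero add_0_left)
  note eq = this
  have mean: "xmean (component \<Phi> \<beta>) y = xmean (\<lambda>x y. 0) y" for y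
    by (simp only: solvesD(3)[OF assms(1)] coef_ypoly(2)[OF less.prems(2)]) (simp add: xmean_def)
  have "periodic_polynomial (\<lambda>x y. 0)"
    unfolding periodic_polynomial_iff using ppoly_zero by blast
  from lifted_heat_unique[OF solvesD(1)[OF assms(1)] this mean eq] show ?case ..
qed

text \<open>The equation is averaged over x. The average of the unknown is prescribed, so
  \<open>xmean_lifted_heat\<close> turns the operator term into derivatives of
  \<open>ypoly\<close>.\<close>

lemma solves_P_eq:
  assumes "solves \<xi> \<Phi> P"
  shows "P y = - (pd2 ypoly y - pd1 (pd1 ypoly) y) + cell_mean (\<lambda>x. Pi_minus \<xi> \<Phi> x y)"
proof (rule zseries_eqI)
  fix \<beta>
  let ?U = "component \<Phi> \<beta>" and ?F = "component (Pi_minus \<xi> \<Phi>) \<beta>"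
  have U: "periodic_polynomial ?U" "\<And>y. xmean ?U y = coef (ypoly y) \<beta>"
    and F: "?F = (\<lambda>x y. lifted_heat ?U x y + coef (P y) \<beta>)"
    by (simp_all only: solvesD[OF assms])
  from U(1) obtain N where N: "ppoly (below N) ?U"
    unfolding periodic_polynomial_iff ..
  have H: "ppoly (below N) (lifted_heat ?U)"
    unfolding lifted_heat_def[abs_def] by (intro ppoly_diff ppoly_dd N)
  have cont: "continuous_on UNIV (\<lambda>x. lifted_heat ?U x y)"
    by (rule ppoly_continuous_on[OF H])
  have "coef (cell_mean (\<lambda>x. Pi_minus \<xi> \<Phi> x y)) \<beta> = (LINT x:unit_cell|lborel. ?F x y)"
    by (simp add: cell_mean_def component_def)
  also have "\<dots> = cell_integral (\<lambda>x. lifted_heat ?U x y + coef (P y) \<beta>)"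
    unfolding F by (intro set_lebesgue_unit_cell continuous_intros cont)
  also have "\<dots> = xmean (lifted_heat ?U) y + coef (P y) \<beta>"
    by (simp add: cell_integral_add[OF cont continuous_on_const] xmean_def)
  also have "xmean (lifted_heat ?U) y = coef (pd2 ypoly y - pd1 (pd1 ypoly) y) \<beta>"
    by (simp add: xmean_lifted_heat[OF N] U(2) pd_def)
  finally show "coef (P y) \<beta> =
      coef (- (pd2 ypoly y - pd1 (pd1 ypoly) y) + cell_mean (\<lambda>x. Pi_minus \<xi> \<Phi> x y)) \<beta>"
    by simp
qed

theorem proposition3p1:
  fixes \<xi> :: "real \<times> real \<Rightarrow> real"
  assumes "smooth \<xi>" and "periodic \<xi>" and "(LINT x:unit_cell|lborel. \<xi> x) = 0"
  shows "(\<exists>!S. case S of (\<Phi>, P) \<Rightarrow> solves \<xi> \<Phi> P) \<and>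
    (\<forall>\<Phi> P. solves \<xi> \<Phi> P \<longrightarrow>
      (\<forall>\<beta>. component \<Phi> \<beta> \<noteq> (\<lambda>_ _. 0) \<longrightarrow> (\<exists>n. \<beta> = unit_mi (Zn n)) \<or> bracket \<beta> \<ge> 0) \<and>
      (\<forall>n x y. component \<Phi> (unit_mi (Zn n)) x y = ymon y (pair_of n)) \<and>
      (\<forall>y. P y = - (pd2 ypoly y - pd1 (pd1 ypoly) y) + cell_mean (\<lambda>x. Pi_minus \<xi> \<Phi> x y)) \<and>
      (\<forall>\<beta>. pdeg (component \<Phi> \<beta>) \<le> ereal (real (pweight \<beta>))))"
proof -
  from assms(2) have "cell_periodic \<xi>"
    by (simp only: periodic_iff_cell_periodic)
  with assms(1) obtain \<Phi>0 P0 where sol: "solves \<xi> \<Phi>0 P0"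
    and deg: "\<And>\<beta>. ppoly (below (Suc (pweight \<beta>))) (component \<Phi>0 \<beta>)"
    by (rule solves_exists) (rule that)
  show ?thesis
  proof (intro conjI allI impI)
    show "\<exists>!S. case S of (\<Phi>, P) \<Rightarrow> solves \<xi> \<Phi> P"
    proof (rule ex1I)
      show "case (\<Phi>0, P0) of (\<Phi>, P) \<Rightarrow> solves \<xi> \<Phi> P"
        by (simp add: sol)
      fix S assume "case S of (\<Phi>, P) \<Rightarrow> solves \<xi> \<Phi> P"
      then have "solves \<xi> (fst S) (snd S)"
        by (simp add: case_prod_beta)
      from solves_unique[OF this sol] show "S = (\<Phi>0, P0)"
        by (intro prod_eqI) simp_all
    qed
    fix \<Phi> P assume \<Phi>: "solves \<xi> \<Phi> P"
    show "(\<exists>n. \<beta> = unit_mi (Zn n)) \<or> bracket \<beta> \<ge> 0" if "component \<Phi> \<beta> \<noteq> (\<lambda>_ _. 0)" for \<beta>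
      using component_negative_bracket[OF \<Phi>, of \<beta>] that by force
    show "component \<Phi> (unit_mi (Zn n)) x y = ymon y (pair_of n)" for n x y
      by (simp only: component_unit[OF \<Phi>])
    show "P y = - (pd2 ypoly y - pd1 (pd1 ypoly) y) + cell_mean (\<lambda>x. Pi_minus \<xi> \<Phi> x y)" for y
      by (rule solves_P_eq[OF \<Phi>])
    \<comment> \<open>The predicate \<open>solves\<close> contains no degree bound; the bound of the
      constructed solution is transferred by uniqueness.\<close>
    show "pdeg (component \<Phi> \<beta>) \<le> ereal (real (pweight \<beta>))" for \<beta>
      using solves_unique[OF \<Phi> sol] deg by (intro pdeg_le) simp
  qed
qed

end
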